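(* Let $\alpha>0$, $0<p\le\infty$, $r>0$, and let $f$ be an entire function on $\mathbb{C}^n$. Then $f\in F^p_\alpha$ if and only if there exists a complex Borel measure $\mu$ on $\mathbb{C}^n$ such that the localized function $|\mu|_r(z)=|\mu|(D(z,r))$ belongs to $L^p(\mathbb{C}^n,dv)$ and $$f(z)=\int_{\mathbb{C}^n}e^{\alpha\langle z,w\rangle-\frac{\alpha}{2}|w|^2}\,d\mu(w)$$ for all $z\in\mathbb{C}^n$.
   Context: $dv$ is Lebesgue volume measure on $\mathbb{C}^n$ and $\langle z,w\rangle=\sum_j z_j\overline{w_j}$. For $\alpha>0$ and $0<p\le\infty$, the Fock space $F^p_\alpha$ is the space of entire functions $f$ on $\mathbb{C}^n$ such that $f(z)e^{-\alpha|z|^2/2}$ belongs to $L^p(\mathbb{C}^n,dv)$. $D(z,r)=\{w\in\mathbb{C}^n:|w-z|<r\}$ is the Euclidean ball. A complex Borel measure on $\mathbb{C}^n$ is here not required to have finite total variation on all of $\mathbb{C}^n$: it is locally finite, i.e. of the form $d\mu=h\,d|\mu|$ with $|\mu|$ a positive Borel measure finite on compact sets and $h$ a Borel function with $|h|=1$. *)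

theory Defs
  imports "HOL-Probability.Essential_Supremum"
begin

definition herm_inner :: "complex ^ 'n \<Rightarrow> complex ^ 'n \<Rightarrow> complex" where
  "herm_inner z w = (\<Sum>j\<in>UNIV. z $ j * cnj (w $ j))"

text \<open>Complex (Frechet) differentiability at every point: the real derivative exists
  and is complex-linear.\<close>

definition entire :: "(complex ^ 'n \<Rightarrow> complex) \<Rightarrow> bool" where
  "entire f \<longleftrightarrow>
     (\<forall>z. \<exists>D. (f has_derivative D) (at z) \<and> (\<forall>c v. D (c *s v) = c * D v))"

definition Lp_space :: "'a measure \<Rightarrow> ennreal \<Rightarrow> ('a \<Rightarrow> 'b::real_normed_vector) set" where
  "Lp_space M p = {g \<in> borel_measurable M.
     if p = \<infinity> then esssup M (\<lambda>x. ereal (norm (g x))) < \<infinity>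
     else integrable M (\<lambda>x. norm (g x) powr enn2real p)}"

definition fock_space :: "real \<Rightarrow> ennreal \<Rightarrow> (complex ^ 'n \<Rightarrow> complex) set" where
  "fock_space \<alpha> p = {f. entire f \<and>
     (\<lambda>z. f z * complex_of_real (exp (- \<alpha> * (norm z)\<^sup>2 / 2))) \<in> Lp_space lborel p}"

text \<open>A locally finite complex Borel measure \<open>\<mu>\<close> is given by its polar decomposition
  \<open>d\<mu> = h d\<nu>\<close> with \<open>\<bar>h\<bar> = 1\<close>, where \<open>\<nu> = \<bar>\<mu>\<bar>\<close>. It need not be a set function on all
  Borel sets, since \<open>\<nu>\<close> may be infinite.\<close>

definition complex_borel_measure ::
    "'a::topological_space measure \<Rightarrow> ('a \<Rightarrow> complex) \<Rightarrow> bool" where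
  "complex_borel_measure \<nu> h \<longleftrightarrow>
     sets \<nu> = sets borel \<and> (\<forall>K. compact K \<longrightarrow> emeasure \<nu> K < \<infinity>) \<and>
     h \<in> borel_measurable borel \<and> (\<forall>w. norm (h w) = 1)"

text \<open>\<open>\<integral> g d\<mu>\<close> exists as an absolutely convergent integral and equals \<open>c\<close>.\<close>

definition has_complex_measure_integral ::
    "'a measure \<Rightarrow> ('a \<Rightarrow> complex) \<Rightarrow> ('a \<Rightarrow> complex) \<Rightarrow> complex \<Rightarrow> bool" where
  "has_complex_measure_integral \<nu> h g c \<longleftrightarrow> has_bochner_integral \<nu> (\<lambda>w. g w * h w) c"

text \<open>Real-valued \<open>measure\<close> loses nothing here: Euclidean balls have compact closure, so they have
  finite measure whenever \<open>complex_borel_measure \<nu> h\<close> holds.\<close>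

definition localized :: "'a::metric_space measure \<Rightarrow> real \<Rightarrow> 'a \<Rightarrow> real" where
  "localized \<nu> r z = measure \<nu> (ball z r)"

end

theory Submission
  imports Defs "HOL-Complex_Analysis.Complex_Analysis" "HOL-Real_Asymp.Real_Asymp" "HOL-Probability.Distributions"
begin

text \<open>
  Write \<open>F z = \<bar>f z\<bar> exp (- \<alpha> \<bar>z\<bar>\<^sup>2 / 2)\<close>. Averaging the one-variable mean value property over the rotations
  \<open>u \<mapsto> e\<^bsup>it\<^esup> u\<close>, which preserve Lebesgue measure, gives \<open>\<integral> g k = g(0) \<integral> k\<close> for entire \<open>g\<close> and radial \<open>k\<close>.
  Applied to \<open>g u = f (z + u) exp (- \<alpha> \<langle>u, z\<rangle>)\<close>, a Gaussian \<open>k\<close> yields the reproducing formula, so that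
  \<open>f\<close> is represented by the measure with density \<open>f w exp (- \<alpha> \<bar>w\<bar>\<^sup>2 / 2)\<close> up to a constant; the
  indicator of a ball as \<open>k\<close> yields the bound of \<open>F z\<^bsup>p\<^esup>\<close> by a local integral of \<open>F\<^bsup>p\<^esup>\<close>, for every \<open>p > 0\<close>,
  which puts the localized total variation of that measure into \<open>L\<^bsup>p\<^esup>\<close>.

  Conversely a representation gives \<open>F z \<le> \<integral> exp (- \<alpha> \<bar>z - w\<bar>\<^sup>2 / 2) d\<bar>\<mu>\<bar>(w)\<close>. Covering the dyadic balls
  around \<open>z\<close> by translates of one fixed family of \<open>r\<close>-balls, whose number grows only polynomially in
  the radius, bounds this by a sum of translates of \<open>\<bar>\<mu>\<bar>\<^sub>r\<close> with rapidly decreasing weights.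
\<close>

section \<open>Lebesgue measure and linear isometries\<close>

lemma nn_integral_lborel_translate:
  fixes f :: "'a::euclidean_space \<Rightarrow> ennreal"
  assumes [measurable]: "f \<in> borel_measurable borel"
  shows "(\<integral>\<^sup>+x. f (c + x) \<partial>lborel) = (\<integral>\<^sup>+x. f x \<partial>lborel)"
proof -
  have "(\<integral>\<^sup>+x. f x \<partial>lborel) = (\<integral>\<^sup>+x. f x \<partial>distr lborel borel ((+) c))"
    by (simp add: lborel_distr_plus)
  also have "\<dots> = (\<integral>\<^sup>+x. f (c + x) \<partial>lborel)"
    by (rule nn_integral_distr) auto
  finally show ?thesis ..
qed

lemma nn_integral_lborel_reflect:
  fixes f :: "'a::euclidean_space \<Rightarrow> ennreal"
  assumes [measurable]: "f \<in> borel_measurable borel"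
  shows "(\<integral>\<^sup>+x. f (c - x) \<partial>lborel) = (\<integral>\<^sup>+x. f x \<partial>lborel)"
proof -
  have "lborel = distr lborel borel (\<lambda>x. c - x)"
    using lborel_affine[of "-1" c] by (simp add: density_1)
  then have "(\<integral>\<^sup>+x. f x \<partial>lborel) = (\<integral>\<^sup>+x. f x \<partial>distr lborel borel (\<lambda>x. c - x))"
    by simp
  also have "\<dots> = (\<integral>\<^sup>+x. f (c - x) \<partial>lborel)"
    by (rule nn_integral_distr) auto
  finally show ?thesis ..
qed

text \<open>Uniqueness of Haar measure: evaluate the double integral of
  \<open>indicator A x * indicator B (x + y)\<close> against \<open>M\<close> and \<open>lborel\<close> in both orders, with \<open>B\<close> the unit ball.\<close>

lemma translation_invariant_eq_lborel:
  fixes M :: "'a::euclidean_space measure"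
  assumes "sigma_finite_measure M" and sets: "sets M = sets borel"
    and inv: "\<And>c. distr M borel ((+) c) = M"
    and unit: "emeasure M (ball 0 1) = emeasure lborel (ball (0::'a) 1)"
  shows "M = lborel"
proof (rule measure_eqI)
  show "sets M = sets lborel" by (simp add: sets)
  fix A assume "A \<in> sets M"
  then have A[measurable]: "A \<in> sets borel" by (simp add: sets)
  interpret sigma_finite_measure M by fact
  interpret pair_sigma_finite M lborel ..
  note sets[measurable_cong]
  let ?B = "ball (0::'a) 1"
  have [measurable]: "?B \<in> sets borel" by simp
  have tr: "(\<integral>\<^sup>+x. f x \<partial>M) = (\<integral>\<^sup>+x. f (c + x) \<partial>M)"
    if [measurable]: "f \<in> borel_measurable borel" for f and c :: 'a
  proof -
    have "(\<integral>\<^sup>+x. f x \<partial>M) = (\<integral>\<^sup>+x. f x \<partial>distr M borel ((+) c))" by (simp add: inv)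
    also have "\<dots> = (\<integral>\<^sup>+x. f (c + x) \<partial>M)" by (rule nn_integral_distr) auto
    finally show ?thesis .
  qed
  \<comment> \<open>The measure of the ball is written as an integral over all shifts
    \<open>x + y\<close>, which does not depend on \<open>x\<close>; this creates the double
    integral whose order is then exchanged.\<close>
  have "emeasure M A * emeasure lborel ?B = (\<integral>\<^sup>+x. indicator A x * emeasure lborel ?B \<partial>M)"
    by (simp add: nn_integral_multc)
  also have "\<dots> = (\<integral>\<^sup>+x. (\<integral>\<^sup>+y. indicator A x * indicator ?B (x + y) \<partial>lborel) \<partial>M)"
  proof (rule nn_integral_cong)
    fix x :: 'a
    have "(\<integral>\<^sup>+y. indicator ?B (x + y) \<partial>lborel) = emeasure lborel ?B"
      by (subst nn_integral_lborel_translate[OF borel_measurable_indicator]) auto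
    then show "indicator A x * emeasure lborel ?B
        = (\<integral>\<^sup>+y. indicator A x * indicator ?B (x + y) \<partial>lborel)"
      by (subst nn_integral_cmult) auto
  qed
  also have "\<dots> = (\<integral>\<^sup>+y. (\<integral>\<^sup>+x. indicator A x * indicator ?B (x + y) \<partial>M) \<partial>lborel)"
    by (rule Fubini'[symmetric]) simp
  \<comment> \<open>Invariance of \<open>M\<close> under translation by \<open>- y\<close> moves the
    shift from the ball to \<open>A\<close>. After a second exchange the integral over
    \<open>y\<close> sees only a reflected copy of \<open>A\<close>.\<close>
  also have "\<dots> = (\<integral>\<^sup>+y. (\<integral>\<^sup>+x. indicator A (x - y) * indicator ?B x \<partial>M) \<partial>lborel)"
  proof (rule nn_integral_cong)
    fix y :: 'a
    show "(\<integral>\<^sup>+x. indicator A x * indicator ?B (x + y) \<partial>M)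
        = (\<integral>\<^sup>+x. indicator A (x - y) * indicator ?B x \<partial>M)"
      using tr[of "\<lambda>x. indicator A x * indicator ?B (x + y)" "-y"] by simp
  qed
  also have "\<dots> = (\<integral>\<^sup>+x. (\<integral>\<^sup>+y. indicator A (x - y) * indicator ?B x \<partial>lborel) \<partial>M)"
    by (rule Fubini') simp
  also have "\<dots> = (\<integral>\<^sup>+x. emeasure lborel A * indicator ?B x \<partial>M)"
  proof (rule nn_integral_cong)
    fix x :: 'a
    have "(\<integral>\<^sup>+y. indicator A (x - y) \<partial>lborel) = emeasure lborel A"
      by (subst nn_integral_lborel_reflect[OF borel_measurable_indicator]) auto
    then show "(\<integral>\<^sup>+y. indicator A (x - y) * indicator ?B x \<partial>lborel)
        = emeasure lborel A * indicator ?B x"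
      by (subst nn_integral_multc) auto
  qed
  also have "\<dots> = emeasure lborel A * emeasure lborel ?B"
    by (simp add: nn_integral_cmult_indicator sets unit)
  finally have eq: "emeasure M A * emeasure lborel ?B = emeasure lborel A * emeasure lborel ?B" .
  have "emeasure lborel ?B \<noteq> 0" "emeasure lborel ?B \<noteq> \<infinity>"
    by (auto simp: emeasure_ball ennreal_eq_0_iff not_le unit_ball_vol_pos)
  with eq show "emeasure M A = emeasure lborel A"
    by (simp add: mult.commute[of _ "emeasure lborel ?B"] ennreal_mult_cancel_left)
qed

text \<open>A surjective linear \<open>T\<close> carries the translation by \<open>d\<close> to the
  translation by \<open>T d\<close>, so the image measure is again translation invariant; balls
  around the origin are preserved, which fixes the normalisation.\<close>

lemma lborel_distr_linear_isometry:
  fixes T :: "'a::euclidean_space \<Rightarrow> 'a"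
  assumes T: "linear T" and norm: "\<And>x. norm (T x) = norm x"
  shows "distr lborel borel T = lborel"
proof (rule translation_invariant_eq_lborel)
  have "inj T"
    using T norm by (metis linear_injective_0 norm_eq_zero)
  then have "surj T" using T linear_inj_imp_surj by blast
  have [measurable]: "T \<in> borel_measurable borel"
    using T by (intro borel_measurable_continuous_onI linear_continuous_on) (simp add: linear_conv_bounded_linear)
  have ball: "T -` ball 0 R = ball 0 R" for R
    by (auto simp: norm)
  show "sigma_finite_measure (distr lborel borel T)"
  proof
    show "\<exists>A. countable A \<and> A \<subseteq> sets (distr lborel borel T) \<and> \<Union> A = space (distr lborel borel T)
       \<and> (\<forall>a\<in>A. emeasure (distr lborel borel T) a \<noteq> \<infinity>)"
    proof (intro exI[of _ "range (\<lambda>n. ball 0 (real n))"] conjI ballI)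
      show "\<Union> (range (\<lambda>n. ball (0::'a) (real n))) = space (distr lborel borel T)"
        by (auto simp: reals_Archimedean2)
    qed (auto simp: emeasure_distr ball emeasure_ball)
  qed
  show "emeasure (distr lborel borel T) (ball 0 1) = emeasure lborel (ball (0::'a) 1)"
    by (simp add: emeasure_distr ball)
  fix c :: 'a
  obtain d where d: "c = T d" using \<open>surj T\<close> by (metis surjD)
  have "distr (distr lborel borel T) borel ((+) c) = distr lborel borel ((+) c \<circ> T)"
    by (rule distr_distr) auto
  also have "(+) c \<circ> T = T \<circ> (+) d"
    using T by (auto simp: d linear_add)
  also have "distr lborel borel (T \<circ> (+) d) = distr (distr lborel borel ((+) d)) borel T"
    by (rule distr_distr[symmetric]) auto
  finally show "distr (distr lborel borel T) borel ((+) c) = distr lborel borel T"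
    by (simp add: lborel_distr_plus)
qed simp

text \<open>Cauchy's formula at the centre of the unit circle: the derivative of the parametrisation
  is 2 pi i times the point itself, which cancels the denominator of the kernel.\<close>

lemma circle_mean_value:
  assumes "g holomorphic_on UNIV"
  shows "(\<integral>t\<in>{0..1}. g (exp (2 * of_real pi * \<i> * of_real t)) \<partial>lborel) = g 0"
proof -
  have c: "continuous_on UNIV g"
    using assms holomorphic_on_imp_continuous_on by blast
  have "((\<lambda>u. g u / (u - 0)) has_contour_integral (2 * of_real pi * \<i> * g 0)) (circlepath 0 1)"
    using assms c by (intro Cauchy_integral_circlepath)
      (auto intro: continuous_on_subset holomorphic_on_subset)
  then have "((\<lambda>t. 2 * of_real pi * \<i> * g (exp (2 * of_real pi * \<i> * of_real t))) has_integral
      (2 * of_real pi * \<i> * g 0)) {0..1}"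
    unfolding has_contour_integral_def
    by (rule has_integral_eq[rotated])
      (simp only: vector_derivative_circlepath01 atLeastAtMost_iff, simp add: circlepath)
  then have "((\<lambda>t. inverse (2 * of_real pi * \<i>) * (2 * of_real pi * \<i> * g (exp (2 * of_real pi * \<i> * of_real t)))) has_integral
      inverse (2 * of_real pi * \<i>) * (2 * of_real pi * \<i> * g 0)) {0..1}"
    by (rule has_integral_mult_right)
  then have hi: "((\<lambda>t. g (exp (2 * of_real pi * \<i> * of_real t))) has_integral g 0) {0..1}"
    by (simp add: field_simps)
  have "set_integrable lborel {0..1} (\<lambda>t. g (exp (2 * of_real pi * \<i> * of_real t)))"
    by (rule borel_integrable_atLeastAtMost') (auto intro!: continuous_intros continuous_on_compose2[OF c])
  then show ?thesis
    using hi set_borel_integral_eq_integral(2) integral_unique by metis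
qed

section \<open>Entire functions on complex Euclidean space\<close>

lemma linear_vector_scalar_mult_right: "linear (\<lambda>v::complex^'n. c *s v)"
  by (rule linearI) (simp_all add: vector_add_ldistrib vec_eq_iff)

lemma linear_vector_scalar_mult_left: "linear (\<lambda>c::complex. c *s (v::complex^'n))"
  by (rule linearI) (simp_all add: vec.scale_left_distrib vec_eq_iff)

lemma norm_vector_scalar_mult: "norm (c *s (v::complex^'n)) = norm c * norm v"
  by (simp add: norm_vec_def L2_set_def norm_mult power_mult_distrib sum_distrib_left[symmetric]
      real_sqrt_mult)

text \<open>Complex linearity of \<open>D\<close> makes the chain rule derivative a multiplication
  by \<open>D w\<close>. Restriction to complex lines is how one-variable theory enters.\<close>

lemma has_field_derivative_along_line:
  fixes g :: "complex ^ 'n \<Rightarrow> complex"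
  assumes D: "(g has_derivative D) (at (z + \<zeta> *s w))" and lin: "\<And>c v. D (c *s v) = c * D v"
  shows "((\<lambda>\<zeta>. g (z + \<zeta> *s w)) has_field_derivative D w) (at \<zeta>)"
proof -
  have "((\<lambda>\<zeta>. z + \<zeta> *s w) has_derivative (\<lambda>\<zeta>. 0 + \<zeta> *s w)) (at \<zeta>)"
    by (intro has_derivative_add has_derivative_const bounded_linear_imp_has_derivative)
      (simp add: linear_conv_bounded_linear[symmetric] linear_vector_scalar_mult_left)
  from diff_chain_at[OF this D]
  have "((\<lambda>\<zeta>. g (z + \<zeta> *s w)) has_derivative (\<lambda>\<zeta>. D (\<zeta> *s w))) (at \<zeta>)"
    by (simp add: o_def)
  moreover have "(\<lambda>\<zeta>. D (\<zeta> *s w)) = (*) (D w)"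
    by (simp add: lin mult.commute fun_eq_iff)
  ultimately show ?thesis
    by (simp add: has_field_derivative_def)
qed

lemma entire_holomorphic_along_line:
  assumes "entire g"
  shows "(\<lambda>\<zeta>. g (z + \<zeta> *s w)) holomorphic_on UNIV"
proof -
  have "\<exists>f'. ((\<lambda>\<zeta>. g (z + \<zeta> *s w)) has_field_derivative f') (at \<zeta>)" for \<zeta>
    using assms has_field_derivative_along_line[of g _ z \<zeta> w] unfolding entire_def by blast
  then show ?thesis
    by (auto simp: holomorphic_on_open)
qed

lemma entire_continuous_on: "entire g \<Longrightarrow> continuous_on S g"
  unfolding entire_def
  by (meson continuous_at_imp_continuous_on has_derivative_continuous)

lemma entire_borel_measurable [measurable_dest]: "entire g \<Longrightarrow> g \<in> borel_measurable borel"
  by (intro borel_measurable_continuous_onI entire_continuous_on)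

lemma entire_translate:
  assumes "entire f"
  shows "entire (\<lambda>u. f (z + u))"
  unfolding entire_def
proof
  fix u
  obtain D where D: "(f has_derivative D) (at (z + u))" "\<And>c v. D (c *s v) = c * D v"
    using assms unfolding entire_def by blast
  have "((\<lambda>u. z + u) has_derivative (\<lambda>u. 0 + u)) (at u)"
    by (intro has_derivative_add has_derivative_const has_derivative_ident)
  from diff_chain_at[OF this D(1)] D(2)
  show "\<exists>D. ((\<lambda>u. f (z + u)) has_derivative D) (at u) \<and> (\<forall>c v. D (c *s v) = c * D v)"
    by (auto simp: o_def)
qed

lemma entire_mult:
  assumes "entire f" "entire g"
  shows "entire (\<lambda>u. f u * g u)"
  unfolding entire_def
proof
  fix u
  obtain D E where D: "(f has_derivative D) (at u)" "\<And>c v. D (c *s v) = c * D v"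
     and E: "(g has_derivative E) (at u)" "\<And>c v. E (c *s v) = c * E v"
    using assms unfolding entire_def by meson
  have "((\<lambda>u. f u * g u) has_derivative (\<lambda>h. f u * E h + D h * g u)) (at u)"
    using D(1) E(1) by (rule has_derivative_mult)
  then show "\<exists>D. ((\<lambda>u. f u * g u) has_derivative D) (at u) \<and> (\<forall>c v. D (c *s v) = c * D v)"
    by (intro exI conjI) (auto simp: D(2) E(2) algebra_simps)
qed

section \<open>The Hermitian inner product and its exponentials\<close>

lemma bounded_linear_herm_inner_left: "bounded_linear (\<lambda>u. herm_inner u z)"
  unfolding herm_inner_def linear_conv_bounded_linear[symmetric]
  by (rule linearI) (simp_all add: algebra_simps sum.distrib scaleR_sum_right)

lemma herm_inner_scale_left: "herm_inner (c *s u) z = c * herm_inner u z"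
  by (simp add: herm_inner_def sum_distrib_left mult.assoc)

lemma entire_exp_herm_inner:
  fixes z :: "complex ^ 'n"
  shows "entire (\<lambda>u. exp (c * herm_inner u z))"
  unfolding entire_def
proof
  fix u :: "complex ^ 'n"
  have "((\<lambda>u. c * herm_inner u z) has_derivative (\<lambda>h. c * herm_inner h z)) (at u)"
    by (intro has_derivative_mult_right bounded_linear_imp_has_derivative bounded_linear_herm_inner_left)
  moreover have "(exp has_derivative (*) (exp (c * herm_inner u z))) (at (c * herm_inner u z))"
    using DERIV_exp[of "c * herm_inner u z"] by (simp add: has_field_derivative_def)
  ultimately have "((\<lambda>u. exp (c * herm_inner u z)) has_derivative
      (\<lambda>h. exp (c * herm_inner u z) * (c * herm_inner h z))) (at u)"
    using diff_chain_at by (fastforce simp: o_def)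
  then show "\<exists>D. ((\<lambda>u. exp (c * herm_inner u z)) has_derivative D) (at u) \<and> (\<forall>a v. D (a *s v) = a * D v)"
    by (intro exI conjI) (auto simp: herm_inner_scale_left)
qed

lemma herm_inner_cnj: "herm_inner w z = cnj (herm_inner z w)"
  by (simp add: herm_inner_def mult.commute)

lemma herm_inner_add_left: "herm_inner (u + v) w = herm_inner u w + herm_inner v w"
  by (simp add: herm_inner_def algebra_simps sum.distrib)

lemma herm_inner_add_right: "herm_inner w (u + v) = herm_inner w u + herm_inner w v"
  by (simp add: herm_inner_def algebra_simps sum.distrib)

lemma herm_inner_self: "herm_inner z z = of_real ((norm z)\<^sup>2)"
  by (simp add: herm_inner_def norm_vec_def L2_set_def sum_nonneg complex_norm_square del: of_real_power)

text \<open>The two mixed terms of the Hermitian expansion are conjugate to each other. This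
  identity converts moduli of exponential kernels into Gaussian weights.\<close>

lemma norm_add_herm: "(norm (z + u :: complex ^ 'n))\<^sup>2 = (norm z)\<^sup>2 + (norm u)\<^sup>2 + 2 * Re (herm_inner u z)"
proof -
  have "of_real ((norm (z + u))\<^sup>2) = of_real ((norm z)\<^sup>2) + of_real ((norm u)\<^sup>2)
      + (herm_inner u z + cnj (herm_inner u z))"
    by (simp only: herm_inner_self[symmetric] herm_inner_add_left herm_inner_add_right
        herm_inner_cnj[of z u, symmetric] add_ac)
  from arg_cong[OF this, of Re] show ?thesis by simp
qed

text \<open>The integral is unchanged when \<open>u\<close> is replaced by \<open>e t *s u\<close>.
  Averaging over \<open>t\<close> and exchanging the integrals leaves, for each fixed
  \<open>u\<close>, the circle mean of \<open>g\<close> on the complex line through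
  \<open>u\<close>, which is \<open>g 0\<close>.\<close>

lemma entire_radial_mean_value:
  fixes g :: "complex ^ 'n \<Rightarrow> complex" and k :: "complex ^ 'n \<Rightarrow> real"
  assumes g: "entire g" and [measurable]: "k \<in> borel_measurable borel"
    and k: "\<And>c u. norm c = 1 \<Longrightarrow> k (c *s u) = k u"
    and int: "integrable lborel (\<lambda>u. g u * of_real (k u))"
  shows "(\<integral>u. g u * of_real (k u) \<partial>lborel) = g 0 * of_real (\<integral>u. k u \<partial>lborel)"
proof -
  define e :: "real \<Rightarrow> complex" where "e t = exp (2 * of_real pi * \<i> * of_real t)" for t
  have e: "norm (e t) = 1" for t by (simp add: e_def)
  have e_cont: "continuous_on UNIV e" unfolding e_def by (intro continuous_intros)
  have scale_cont: "continuous_on UNIV (\<lambda>x. e (fst x) *s (snd x :: complex ^ 'n))"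
    unfolding vector_scalar_mult_def
    by (intro continuous_on_vec_lambda continuous_intros continuous_on_compose2[OF e_cont]) auto
  have [measurable]: "g \<in> borel_measurable borel" by (rule entire_borel_measurable[OF g])
  have [measurable]: "(\<lambda>x. e (fst x) *s (snd x :: complex ^ 'n)) \<in> borel \<Otimes>\<^sub>M borel \<rightarrow>\<^sub>M borel"
    using borel_measurable_continuous_onI[OF scale_cont] by (simp add: borel_prod)
  have [measurable]: "(\<lambda>u::complex ^ 'n. e t *s u) \<in> borel \<rightarrow>\<^sub>M borel" for t
    by (intro borel_measurable_continuous_onI linear_continuous_on)
      (simp add: linear_conv_bounded_linear[symmetric] linear_vector_scalar_mult_right)
  define I :: "real \<Rightarrow> real" where "I = indicator {0..1}"
  have [measurable]: "I \<in> borel_measurable borel" unfolding I_def by simp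
  define G where "G u = g u * of_real (k u)" for u
  have [measurable]: "G \<in> borel_measurable borel" unfolding G_def by simp
  have rot: "distr lborel borel (\<lambda>u::complex ^ 'n. e t *s u) = lborel" for t
    by (rule lborel_distr_linear_isometry)
      (simp_all add: linear_vector_scalar_mult_right norm_vector_scalar_mult e)
  have rot_int: "(\<integral>u. G (e t *s u) \<partial>lborel) = (\<integral>u. G u \<partial>lborel)" for t
    by (subst (2) rot[symmetric, of t]) (simp add: integral_distr)
  have rot_nn: "(\<integral>\<^sup>+u. norm (G (e t *s u)) \<partial>lborel) = (\<integral>\<^sup>+u. norm (G u) \<partial>lborel)" for t
    by (subst (2) rot[symmetric, of t]) (simp add: nn_integral_distr)
  have fin: "(\<integral>\<^sup>+u. norm (G u) \<partial>lborel) < \<infinity>"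
    using int by (simp add: G_def integrable_iff_bounded)
  \<comment> \<open>Fubini requires absolute integrability on the product: by rotation invariance
    the inner integral of the norm is the same for every \<open>t\<close>, and \<open>I\<close>
    restricts \<open>t\<close> to an interval of length 1.\<close>
  have prod: "integrable (lborel \<Otimes>\<^sub>M lborel) (\<lambda>(t, u). I t *\<^sub>R G (e t *s u))"
    unfolding integrable_iff_bounded
  proof
    show "(\<lambda>(t, u). I t *\<^sub>R G (e t *s u)) \<in> borel_measurable (lborel \<Otimes>\<^sub>M lborel)"
      by (simp add: split_beta)
    have "(\<integral>\<^sup>+x. norm (case x of (t, u) \<Rightarrow> I t *\<^sub>R G (e t *s u)) \<partial>(lborel \<Otimes>\<^sub>M lborel))
        = (\<integral>\<^sup>+t. (\<integral>\<^sup>+u. ennreal (I t) * norm (G (e t *s u)) \<partial>lborel) \<partial>lborel)"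
      by (subst lborel.nn_integral_fst[symmetric])
        (auto simp: split_beta I_def ennreal_mult' intro!: nn_integral_cong split: split_indicator)
    also have "\<dots> = (\<integral>\<^sup>+t. ennreal (I t) * (\<integral>\<^sup>+u. norm (G u) \<partial>lborel) \<partial>lborel)"
      by (intro nn_integral_cong) (subst nn_integral_cmult, auto simp: rot_nn)
    also have "\<dots> = (\<integral>\<^sup>+u. norm (G u) \<partial>lborel)"
      by (subst nn_integral_multc) (auto simp: I_def ennreal_indicator)
    finally show "(\<integral>\<^sup>+x. norm (case x of (t, u) \<Rightarrow> I t *\<^sub>R G (e t *s u)) \<partial>(lborel \<Otimes>\<^sub>M lborel)) < \<infinity>"
      using fin by simp
  qed
  have "(\<integral>u. G u \<partial>lborel) = (\<integral>t. I t *\<^sub>R (\<integral>u. G u \<partial>lborel) \<partial>lborel)"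
    by (simp add: I_def)
  also have "\<dots> = (\<integral>t. (\<integral>u. I t *\<^sub>R G (e t *s u) \<partial>lborel) \<partial>lborel)"
    by (simp add: rot_int)
  also have "\<dots> = (\<integral>u. (\<integral>t. I t *\<^sub>R G (e t *s u) \<partial>lborel) \<partial>lborel)"
    using lborel_pair.Fubini_integral[OF prod] by simp
  also have "\<dots> = (\<integral>u. g 0 * of_real (k u) \<partial>lborel)"
  proof (intro Bochner_Integration.integral_cong refl)
    fix u :: "complex ^ 'n"
    have "(\<integral>t\<in>{0..1}. g (0 + e t *s u) \<partial>lborel) = g 0"
      using circle_mean_value[OF entire_holomorphic_along_line[OF g, of 0 u]] by (simp add: e_def)
    then have "(\<integral>t. I t *\<^sub>R g (e t *s u) \<partial>lborel) * of_real (k u) = g 0 * of_real (k u)"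
      by (simp add: set_lebesgue_integral_def I_def)
    \<comment> \<open>The weight \<open>k\<close> is constant on the orbit of \<open>u\<close> and
      leaves the integral over \<open>t\<close>.\<close>
    moreover have "(\<lambda>t. I t *\<^sub>R G (e t *s u)) = (\<lambda>t. (I t *\<^sub>R g (e t *s u)) * of_real (k u))"
      by (simp add: G_def k e fun_eq_iff)
    ultimately show "(\<integral>t. I t *\<^sub>R G (e t *s u) \<partial>lborel) = g 0 * of_real (k u)"
      by (simp only: integral_mult_left_zero)
  qed
  also have "\<dots> = g 0 * of_real (\<integral>u. k u \<partial>lborel)" by simp
  finally show ?thesis by (simp add: G_def)
qed

section \<open>Mean values of powers\<close>

text \<open>The radial mean value property with the indicator of a ball as weight, applied to
  \<open>g\<close> translated by \<open>x\<close>.\<close>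

lemma entire_mean_ball:
  fixes g :: "complex ^ 'n \<Rightarrow> complex"
  assumes "entire g" and s: "s > 0"
  shows "ennreal (norm (g x) * measure lborel (ball x s))
    \<le> (\<integral>\<^sup>+u. ennreal (norm (g u)) * indicator (ball x s) u \<partial>lborel)"
proof -
  define h where "h u = g (x + u)" for u
  have h: "entire h" unfolding h_def by (rule entire_translate) fact
  note [measurable] = entire_borel_measurable[OF assms(1)] entire_borel_measurable[OF h]
  have [measurable]: "ball (0 :: complex ^ 'n) s \<in> sets borel" "ball x s \<in> sets borel" by simp_all
  let ?k = "indicator (ball 0 s) :: complex ^ 'n \<Rightarrow> real"
  have "integrable lborel (\<lambda>u. indicator (cball 0 s) u *\<^sub>R h u)"
    by (intro borel_integrable_compact entire_continuous_on h compact_cball)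
  then have int: "integrable lborel (\<lambda>u. h u * of_real (?k u))"
    by (rule Bochner_Integration.integrable_bound) (auto split: split_indicator)
  have "(\<integral>u. h u * of_real (?k u) \<partial>lborel) = h 0 * of_real (\<integral>u. ?k u \<partial>lborel)"
    by (rule entire_radial_mean_value[OF h _ _ int])
      (auto split: split_indicator simp: norm_vector_scalar_mult)
  then have "norm (g x) * measure lborel (ball 0 s :: (complex ^ 'n) set) = norm (\<integral>u. h u * of_real (?k u) \<partial>lborel)"
    by (simp add: h_def norm_mult)
  also have "ennreal \<dots> \<le> (\<integral>\<^sup>+u. norm (h u * of_real (?k u)) \<partial>lborel)"
    by (rule integral_norm_bound_ennreal[OF int])
  also have "\<dots> = (\<integral>\<^sup>+u. ennreal (norm (g (x + u))) * indicator (ball x s) (x + u) \<partial>lborel)"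
    by (intro nn_integral_cong) (auto split: split_indicator simp: h_def dist_norm norm_mult)
  also have "\<dots> = (\<integral>\<^sup>+u. ennreal (norm (g u)) * indicator (ball x s) u \<partial>lborel)"
    by (rule nn_integral_lborel_translate) simp
  finally show ?thesis
    using s content_ball_conv_unit_ball[of s x] content_ball_conv_unit_ball[of s "0 :: complex ^ 'n"]
    by simp
qed

text \<open>For \<open>q \<ge> 1\<close> the bound \<open>t \<le> l + l\<^bsup>1-q\<^esup> t\<^bsup>q\<^esup>\<close> with \<open>l = \<bar>g 0\<bar> / 2\<close> replaces Jensen's inequality.\<close>

lemma entire_mean_ball_powr_ge_1:
  fixes g :: "complex ^ 'n \<Rightarrow> complex"
  assumes g: "entire g" and q: "q \<ge> 1"
  shows "ennreal (norm (g 0) powr q)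
    \<le> ennreal (2 powr q / measure lborel (ball (0 :: complex ^ 'n) 1)) *
       (\<integral>\<^sup>+u. ennreal (norm (g u) powr q) * indicator (ball 0 1) u \<partial>lborel)"
    (is "_ \<le> ennreal (_ / ?V) * ?I")
proof (cases "g 0 = 0 \<or> ?I = \<infinity>")
  case True
  then show ?thesis
    by (auto simp: ennreal_mult_top zero_less_divide_iff)
next
  case False
  note [measurable] = entire_borel_measurable[OF g]
  have ball [measurable]: "ball (0 :: complex ^ 'n) 1 \<in> sets borel" by simp
  have V: "?V > 0" by simp
  define l where "l = norm (g 0) / 2"
  have l: "l > 0" using False by (simp add: l_def)
  obtain I where I: "?I = ennreal I" "I \<ge> 0" using False by (cases ?I) auto
  have key: "norm (g u) \<le> l + l powr (1 - q) * norm (g u) powr q" for u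
  proof (cases "norm (g u) \<le> l")
    case True
    then show ?thesis by (simp add: add_increasing2)
  next
    case False
    have "norm (g u) = norm (g u) powr (1 - q) * norm (g u) powr q"
      using False l by (simp add: powr_add[symmetric])
    also have "\<dots> \<le> l powr (1 - q) * norm (g u) powr q"
      using False l q by (intro mult_right_mono powr_mono2') auto
    finally show ?thesis using l by simp
  qed
  have "ennreal (norm (g 0) * ?V)
      \<le> (\<integral>\<^sup>+u. ennreal (norm (g u)) * indicator (ball 0 1) u \<partial>lborel)"
    by (rule entire_mean_ball[OF g]) simp
  also have "\<dots> \<le> (\<integral>\<^sup>+u. ennreal l * indicator (ball 0 1) u
      + ennreal (l powr (1 - q)) * (ennreal (norm (g u) powr q) * indicator (ball 0 1) u) \<partial>lborel)"
  proof (rule nn_integral_mono)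
    fix u :: "complex ^ 'n"
    show "ennreal (norm (g u)) * indicator (ball 0 1) u \<le> ennreal l * indicator (ball 0 1) u
      + ennreal (l powr (1 - q)) * (ennreal (norm (g u) powr q) * indicator (ball 0 1) u)"
      using ennreal_leI[OF key[of u]] l by (cases "u \<in> ball 0 1") (simp_all add: ennreal_mult)
  qed
  also have "\<dots> = ennreal l * emeasure lborel (ball (0 :: complex ^ 'n) 1) + ennreal (l powr (1 - q)) * ?I"
    by (simp add: nn_integral_add nn_integral_cmult)
  also have "\<dots> = ennreal (l * ?V + l powr (1 - q) * I)"
    using l V I emeasure_lborel_ball_finite[of "0 :: complex ^ 'n" 1]
    by (simp add: emeasure_eq_ennreal_measure ennreal_mult ennreal_plus)
  finally have "norm (g 0) * ?V \<le> l * ?V + l powr (1 - q) * I"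
    using l V I by (subst (asm) ennreal_le_iff) auto
  \<comment> \<open>Since \<open>norm (g 0) = 2 * l\<close>, the term \<open>l * ?V\<close> on the
    right is absorbed by half of the left side.\<close>
  then have "l * ?V \<le> l powr (1 - q) * I" by (simp add: l_def)
  then have "l powr (q - 1) * (l * ?V) \<le> l powr (q - 1) * (l powr (1 - q) * I)"
    by (rule mult_left_mono) simp
  moreover have "l powr (q - 1) * l = l powr q"
    using l powr_add[of l "q - 1" 1] by simp
  moreover have "l powr (q - 1) * l powr (1 - q) = 1"
    using l by (simp add: powr_add[symmetric])
  ultimately have "l powr q * ?V \<le> I" by (simp flip: mult.assoc)
  moreover have "norm (g 0) powr q = 2 powr q * l powr q"
    by (simp add: l_def flip: powr_mult)
  ultimately have "norm (g 0) powr q \<le> 2 powr q / ?V * I"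
    using V by (simp add: field_simps)
  then show ?thesis
    using V I by (simp add: ennreal_mult[symmetric])
qed

text \<open>For \<open>q < 1\<close> the mean value inequality cannot be raised to the power \<open>q\<close>. Writing
  \<open>\<bar>g\<bar> = \<bar>g\<bar>\<^bsup>1-q\<^esup> \<bar>g\<bar>\<^bsup>q\<^esup>\<close>, the first factor is absorbed by the maximum over the unit ball of
  \<open>(1 - \<bar>x\<bar>)\<^bsup>N\<^esup> \<bar>g x\<bar>\<close>, where \<open>N\<close> is chosen such that all powers of the radius cancel.\<close>

lemma entire_mean_ball_powr_less_1:
  fixes g :: "complex ^ 'n \<Rightarrow> complex"
  assumes g: "entire g" and q: "0 < q" "q < 1"
  defines "N \<equiv> DIM(complex ^ 'n) / q"
  shows "ennreal (norm (g 0) powr q)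
    \<le> ennreal (2 powr N / measure lborel (ball (0 :: complex ^ 'n) 1)) *
       (\<integral>\<^sup>+u. ennreal (norm (g u) powr q) * indicator (ball 0 1) u \<partial>lborel)"
    (is "_ \<le> ennreal (_ / ?V) * ?I")
proof (cases "g 0 = 0 \<or> ?I = \<infinity>")
  case True
  then show ?thesis
    by (auto simp: ennreal_mult_top zero_less_divide_iff)
next
  case False
  note [measurable] = entire_borel_measurable[OF g]
  have ball [measurable]: "ball (0 :: complex ^ 'n) 1 \<in> sets borel" by simp
  have V: "?V > 0" by simp
  have N: "N > 0" using q by (simp add: N_def)
  obtain I where I: "?I = ennreal I" "I \<ge> 0" using False by (cases ?I) auto
  define m where "m x = (1 - norm x) powr N * norm (g x)" for x
  have "continuous_on (cball 0 1) m"
    unfolding m_def using N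
    by (intro continuous_on_mult continuous_on_powr' continuous_intros entire_continuous_on g) auto
  then obtain x0 where x0: "x0 \<in> cball 0 1" and max: "\<And>y. y \<in> cball 0 1 \<Longrightarrow> m y \<le> m x0"
    using continuous_attains_sup[of "cball 0 1" m] by force
  have m0: "norm (g 0) \<le> m x0" using max[of 0] by (simp add: m_def)
  then have m_pos: "m x0 > 0" using False by (smt (verit) zero_less_norm_iff)
  \<comment> \<open>The maximum is not attained on the boundary, where \<open>m\<close> vanishes,
    because \<open>m x0\<close> is at least \<open>norm (g 0) > 0\<close>.\<close>
  have "norm x0 \<noteq> 1" using m_pos N by (auto simp: m_def)
  with x0 have x01: "norm x0 < 1" by simp
  \<comment> \<open>Half the distance to the unit sphere: a point \<open>y\<close> of
    \<open>ball x0 s\<close> still has \<open>1 - norm y \<ge> s\<close>, so the maximality of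
    \<open>m x0\<close> bounds \<open>g\<close> there.\<close>
  define s where "s = (1 - norm x0) / 2"
  have s: "s > 0" using x01 by (simp add: s_def)
  define P where "P = s powr N"
  have P: "P > 0" using s by (simp add: P_def)
  \<comment> \<open>The exponent \<open>N\<close> is chosen for this identity:
    \<open>P powr q\<close> is exactly the factor by which the volume of a ball of radius
    \<open>s\<close> scales.\<close>
  have Pq: "P powr q = s ^ DIM(complex ^ 'n)"
    using q powr_realpow[OF s, of "DIM(complex ^ 'n)"] by (simp add: P_def powr_powr N_def)
  have gx0: "m x0 = 2 powr N * P * norm (g x0)"
  proof -
    have "1 - norm x0 = 2 * s" by (simp add: s_def)
    then show ?thesis by (simp add: m_def P_def powr_mult)
  qed
  have sub: "norm (g y) \<le> m x0 / P \<and> y \<in> ball 0 1" if "y \<in> ball x0 s" for y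
  proof -
    have "norm y \<le> norm x0 + s"
      using that norm_triangle_sub[of y x0] by (simp add: dist_norm norm_minus_commute)
    then have *: "s \<le> 1 - norm y" unfolding s_def by argo
    have "P * norm (g y) \<le> m y"
      unfolding m_def P_def using * s N by (intro mult_right_mono powr_mono2) auto
    also have "m y \<le> m x0" using * s by (intro max) simp
    finally show ?thesis using P * s by (simp add: field_simps)
  qed
  have key: "norm (g y) \<le> (m x0 / P) powr (1 - q) * norm (g y) powr q" if "y \<in> ball x0 s" for y
  proof (cases "g y = 0")
    case False
    then have "norm (g y) = norm (g y) powr (1 - q) * norm (g y) powr q"
      by (simp add: powr_add[symmetric])
    also have "\<dots> \<le> (m x0 / P) powr (1 - q) * norm (g y) powr q"
      using sub[OF that] q by (intro mult_right_mono powr_mono2) auto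
    finally show ?thesis .
  qed simp
  have "ennreal (norm (g x0) * measure lborel (ball x0 s))
      \<le> (\<integral>\<^sup>+u. ennreal (norm (g u)) * indicator (ball x0 s) u \<partial>lborel)"
    by (rule entire_mean_ball[OF g s])
  also have "\<dots> \<le> (\<integral>\<^sup>+u. ennreal ((m x0 / P) powr (1 - q)) *
      (ennreal (norm (g u) powr q) * indicator (ball 0 1) u) \<partial>lborel)"
  proof (rule nn_integral_mono)
    fix u :: "complex ^ 'n"
    show "ennreal (norm (g u)) * indicator (ball x0 s) u \<le> ennreal ((m x0 / P) powr (1 - q)) *
      (ennreal (norm (g u) powr q) * indicator (ball 0 1) u)"
      using ennreal_leI[OF key[of u]] sub[of u]
      by (cases "u \<in> ball x0 s") (simp_all add: ennreal_mult)
  qed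
  also have "\<dots> = ennreal ((m x0 / P) powr (1 - q)) * ?I"
    by (subst nn_integral_cmult) auto
  also have "\<dots> = ennreal ((m x0 / P) powr (1 - q) * I)"
    using I by (simp add: ennreal_mult)
  finally have "norm (g x0) * measure lborel (ball x0 s) \<le> (m x0 / P) powr (1 - q) * I"
    using I by (subst (asm) ennreal_le_iff) auto
  then have le: "norm (g x0) * (P powr q * ?V) \<le> (m x0 / P) powr (1 - q) * I"
    using s by (simp add: Pq content_ball_conv_unit_ball[of s x0])
  \<comment> \<open>\<open>R\<close> is the bound for \<open>norm (g y)\<close> on
    \<open>ball x0 s\<close>. Multiplying by \<open>R powr (q - 1)\<close> produces
    \<open>R powr q * P powr q = m x0 powr q\<close>, in which \<open>s\<close> no longer
    occurs.\<close>
  define R where "R = m x0 / P"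
  have R: "R > 0" and mR: "m x0 = R * P" using m_pos P by (auto simp: R_def)
  have "norm (g x0) = R / 2 powr N"
    using gx0 P by (simp add: R_def)
  with le have "R * (P powr q * ?V) / 2 powr N \<le> R powr (1 - q) * I"
    by (simp add: R_def)
  then have "R powr (q - 1) * (R * (P powr q * ?V) / 2 powr N) \<le> R powr (q - 1) * (R powr (1 - q) * I)"
    by (rule mult_left_mono) simp
  moreover have "R powr (q - 1) * R = R powr q"
    using R powr_add[of R "q - 1" 1] by simp
  moreover have "R powr (q - 1) * R powr (1 - q) = 1"
    using R by (simp add: powr_add[symmetric])
  ultimately have "R powr q * P powr q * ?V / 2 powr N \<le> I"
    by (simp add: mult.assoc[symmetric])
  then have "m x0 powr q * ?V / 2 powr N \<le> I"
    by (simp add: mR powr_mult)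
  then have "m x0 powr q \<le> 2 powr N / ?V * I"
    using V by (simp add: field_simps)
  moreover have "norm (g 0) powr q \<le> m x0 powr q"
    using m0 q by (intro powr_mono2) auto
  ultimately have "norm (g 0) powr q \<le> 2 powr N / ?V * I" by linarith
  then show ?thesis
    using V I by (simp add: ennreal_mult[symmetric])
qed

text \<open>One constant serves all entire functions at once, so the bound can be applied to the
  whole family of translates of \<open>f\<close> without losing uniformity.\<close>

lemma entire_mean_ball_powr:
  assumes "q > 0"
  obtains C where "C \<ge> 0" "\<And>g :: complex ^ 'n \<Rightarrow> complex. entire g \<Longrightarrow>
     ennreal (norm (g 0) powr q)
       \<le> ennreal C * (\<integral>\<^sup>+u. ennreal (norm (g u) powr q) * indicator (ball 0 1) u \<partial>lborel)"
proof (cases "q \<ge> 1")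
  case True
  show ?thesis
    by (rule that[OF _ entire_mean_ball_powr_ge_1]) (use True in auto)
next
  case False
  show ?thesis
    by (rule that[OF _ entire_mean_ball_powr_less_1]) (use False assms in auto)
qed

section \<open>Local bounds and the reproducing formula\<close>

definition fock_modulus :: "real \<Rightarrow> (complex ^ 'n \<Rightarrow> complex) \<Rightarrow> complex ^ 'n \<Rightarrow> real" where
  "fock_modulus \<alpha> f z = norm (f z) * exp (- \<alpha> * (norm z)\<^sup>2 / 2)"

lemma fock_modulus_nonneg [simp]: "0 \<le> fock_modulus \<alpha> f z"
  by (simp add: fock_modulus_def)

lemma borel_measurable_fock_modulus:
  assumes "entire f"
  shows "fock_modulus \<alpha> f \<in> borel_measurable borel"
proof -
  note [measurable] = entire_borel_measurable[OF assms]
  show ?thesis unfolding fock_modulus_def[abs_def] by measurable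
qed

text \<open>The factor \<open>exp (- \<alpha> \<bar>z\<bar>\<^sup>2 / 2)\<close> that would make the translation isometric for the weighted
  modulus is omitted, so that the value at \<open>0\<close> is \<open>f z\<close>.\<close>

definition weyl_translate :: "real \<Rightarrow> (complex ^ 'n \<Rightarrow> complex) \<Rightarrow> complex ^ 'n \<Rightarrow> complex ^ 'n \<Rightarrow> complex" where
  "weyl_translate \<alpha> f z u = f (z + u) * exp (- of_real \<alpha> * herm_inner u z)"

lemma entire_weyl_translate: "entire f \<Longrightarrow> entire (weyl_translate \<alpha> f z)"
  unfolding weyl_translate_def[abs_def] by (intro entire_mult entire_translate entire_exp_herm_inner)

lemma weyl_translate_0 [simp]: "weyl_translate \<alpha> f z 0 = f z"
  by (simp add: weyl_translate_def herm_inner_def)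

text \<open>The cross term in the expansion of \<open>(norm (z + u))\<^sup>2\<close> is compensated
  by the modulus of \<open>exp (- of_real \<alpha> * herm_inner u z)\<close>.\<close>

lemma norm_weyl_translate:
  "norm (weyl_translate \<alpha> f z u)
    = fock_modulus \<alpha> f (z + u) * exp (\<alpha> * (norm z)\<^sup>2 / 2) * exp (\<alpha> * (norm u)\<^sup>2 / 2)"
  by (simp add: weyl_translate_def fock_modulus_def norm_mult norm_add_herm exp_add[symmetric]
      mult.assoc) (simp add: field_simps)

text \<open>The mean bound at the origin is applied to \<open>weyl_translate \<alpha> f z\<close>.
  The Gaussian factor in \<open>z\<close> appears on both sides and cancels, and the one in
  \<open>u\<close> is at most \<open>exp (\<alpha> / 2)\<close> on the unit ball, so the constant is
  uniform in \<open>z\<close>.\<close>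

lemma fock_modulus_powr_le:
  fixes f :: "complex ^ 'n \<Rightarrow> complex"
  assumes f: "entire f" and \<alpha>: "\<alpha> > 0" and q: "q > 0"
  obtains C where "C \<ge> 0" "\<And>z. ennreal (fock_modulus \<alpha> f z powr q)
      \<le> ennreal C * (\<integral>\<^sup>+u. ennreal (fock_modulus \<alpha> f u powr q) * indicator (ball z 1) u \<partial>lborel)"
proof -
  note [measurable] = borel_measurable_fock_modulus[OF f]
  obtain C where C: "C \<ge> 0" "\<And>g :: complex ^ 'n \<Rightarrow> complex. entire g \<Longrightarrow>
     ennreal (norm (g 0) powr q)
       \<le> ennreal C * (\<integral>\<^sup>+u. ennreal (norm (g u) powr q) * indicator (ball 0 1) u \<partial>lborel)"
    using entire_mean_ball_powr[OF q] by blast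
  have "ennreal (fock_modulus \<alpha> f z powr q)
      \<le> ennreal (C * exp (\<alpha> / 2) powr q) * (\<integral>\<^sup>+u. ennreal (fock_modulus \<alpha> f u powr q) * indicator (ball z 1) u \<partial>lborel)"
    for z :: "complex ^ 'n"
  proof -
    have [measurable]: "ball z 1 \<in> sets borel" by simp
    define E where "E = exp (\<alpha> * (norm z)\<^sup>2 / 2)"
    have E: "E > 0" by (simp add: E_def)
    let ?g = "weyl_translate \<alpha> f z"
    have fz: "norm (f z) = E * fock_modulus \<alpha> f z"
      by (simp add: E_def fock_modulus_def exp_minus)
    have le: "norm (?g u) \<le> E * exp (\<alpha> / 2) * fock_modulus \<alpha> f (z + u)" if "u \<in> ball 0 1" for u
    proof -
      have "(norm u)\<^sup>2 \<le> 1" using that by (simp add: power_le_one)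
      then have "exp (\<alpha> * (norm u)\<^sup>2 / 2) \<le> exp (\<alpha> / 2)" using \<alpha> by simp
      then have "fock_modulus \<alpha> f (z + u) * E * exp (\<alpha> * (norm u)\<^sup>2 / 2)
          \<le> fock_modulus \<alpha> f (z + u) * E * exp (\<alpha> / 2)"
        using E by (intro mult_left_mono) auto
      then show ?thesis by (simp add: norm_weyl_translate E_def mult_ac)
    qed
    have "(\<integral>\<^sup>+u. ennreal (norm (?g u) powr q) * indicator (ball 0 1) u \<partial>lborel)
       \<le> (\<integral>\<^sup>+u. ennreal (E powr q * exp (\<alpha> / 2) powr q) *
            (ennreal (fock_modulus \<alpha> f (z + u) powr q) * indicator (ball z 1) (z + u)) \<partial>lborel)"
    proof (rule nn_integral_mono)
      fix u :: "complex ^ 'n"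
      have ball: "z + u \<in> ball z 1 \<longleftrightarrow> u \<in> ball 0 1" by (simp add: dist_norm)
      show "ennreal (norm (?g u) powr q) * indicator (ball 0 1) u \<le>
        ennreal (E powr q * exp (\<alpha> / 2) powr q) *
            (ennreal (fock_modulus \<alpha> f (z + u) powr q) * indicator (ball z 1) (z + u))"
      proof (cases "u \<in> ball 0 1")
        case True
        have "norm (?g u) powr q \<le> (E * exp (\<alpha> / 2) * fock_modulus \<alpha> f (z + u)) powr q"
          using le[OF True] q by (intro powr_mono2) auto
        then have "ennreal (norm (?g u) powr q) \<le>
            ennreal (E powr q * exp (\<alpha> / 2) powr q * fock_modulus \<alpha> f (z + u) powr q)"
          by (intro ennreal_leI) (simp add: powr_mult)
        then show ?thesis using True ball by (simp add: ennreal_mult)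
      qed simp
    qed
    also have "\<dots> = (\<integral>\<^sup>+u. ennreal (E powr q * exp (\<alpha> / 2) powr q) *
            (ennreal (fock_modulus \<alpha> f u powr q) * indicator (ball z 1) u) \<partial>lborel)"
      by (rule nn_integral_lborel_translate) simp
    also have "\<dots> = ennreal (E powr q * exp (\<alpha> / 2) powr q) *
        (\<integral>\<^sup>+u. ennreal (fock_modulus \<alpha> f u powr q) * indicator (ball z 1) u \<partial>lborel)"
      by (rule nn_integral_cmult) simp
    finally have I_le: "(\<integral>\<^sup>+u. ennreal (norm (?g u) powr q) * indicator (ball 0 1) u \<partial>lborel)
      \<le> ennreal (E powr q * exp (\<alpha> / 2) powr q) *
        (\<integral>\<^sup>+u. ennreal (fock_modulus \<alpha> f u powr q) * indicator (ball z 1) u \<partial>lborel)" .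
    have "ennreal (E powr q) * ennreal (fock_modulus \<alpha> f z powr q) = ennreal (norm (?g 0) powr q)"
      by (simp add: fz powr_mult ennreal_mult)
    also have "\<dots> \<le> ennreal C * (\<integral>\<^sup>+u. ennreal (norm (?g u) powr q) * indicator (ball 0 1) u \<partial>lborel)"
      by (rule C(2)[OF entire_weyl_translate[OF f]])
    also have "\<dots> \<le> ennreal C * (ennreal (E powr q * exp (\<alpha> / 2) powr q) *
        (\<integral>\<^sup>+u. ennreal (fock_modulus \<alpha> f u powr q) * indicator (ball z 1) u \<partial>lborel))"
      using I_le by (rule mult_left_mono) simp
    finally have "ennreal (E powr q) * ennreal (fock_modulus \<alpha> f z powr q)
      \<le> ennreal (E powr q) * (ennreal (C * exp (\<alpha> / 2) powr q) *
        (\<integral>\<^sup>+u. ennreal (fock_modulus \<alpha> f u powr q) * indicator (ball z 1) u \<partial>lborel))"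
      using C(1) by (simp add: ennreal_mult mult_ac)
    then show ?thesis
      using E by (subst (asm) ennreal_mult_le_mult_iff) auto
  qed
  with C(1) show thesis by (intro that[of "C * exp (\<alpha> / 2) powr q"]) auto
qed

section \<open>Gaussian integrals and the reproducing formula\<close>

lemma nn_integral_gaussian_finite:
  assumes "\<beta> > 0"
  shows "(\<integral>\<^sup>+x. ennreal (exp (- \<beta> * (norm (x :: 'a::euclidean_space))\<^sup>2)) \<partial>lborel) < \<infinity>"
proof -
  \<comment> \<open>The standard deviation for which \<open>exp (- \<beta> * t\<^sup>2)\<close> is a
    multiple of the normal density; the integral over the whole space then factors over the
    coordinates.\<close>
  define \<sigma> where "\<sigma> = sqrt (1 / (2 * \<beta>))"
  have \<sigma>: "\<sigma> > 0" "2 * \<sigma>\<^sup>2 = 1 / \<beta>" using assms by (simp_all add: \<sigma>_def)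
  have gauss: "exp (- \<beta> * t\<^sup>2) = sqrt (2 * pi * \<sigma>\<^sup>2) * normal_density 0 \<sigma> t" for t
    using \<sigma> assms by (simp add: normal_density_def field_simps)
  have "integrable lborel (\<lambda>t. sqrt (2 * pi * \<sigma>\<^sup>2) * normal_density 0 \<sigma> t)"
    using \<sigma> by simp
  then have 1: "integrable lborel (\<lambda>t. exp (- \<beta> * t\<^sup>2))"
    unfolding gauss .
  then have fin: "(\<integral>\<^sup>+t. ennreal (exp (- \<beta> * t\<^sup>2)) \<partial>lborel) < \<infinity>"
    by (simp add: integrable_iff_bounded)
  have "ennreal (exp (- \<beta> * (norm x)\<^sup>2)) = (\<Prod>b\<in>Basis. ennreal (exp (- \<beta> * (x \<bullet> b)\<^sup>2)))" for x :: 'a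
  proof -
    have "(norm x)\<^sup>2 = (\<Sum>b\<in>Basis. (x \<bullet> b)\<^sup>2)"
      unfolding power2_norm_eq_inner by (subst euclidean_inner) (simp add: power2_eq_square)
    then show ?thesis
      by (simp add: prod_ennreal exp_sum[symmetric] sum_distrib_left sum_negf)
  qed
  then have "(\<integral>\<^sup>+x. ennreal (exp (- \<beta> * (norm (x :: 'a))\<^sup>2)) \<partial>lborel)
      = (\<integral>\<^sup>+x. (\<Prod>b\<in>Basis. ennreal (exp (- \<beta> * (x \<bullet> b)\<^sup>2))) \<partial>(lborel :: 'a measure))"
    by simp
  also have "\<dots> = (\<Prod>b\<in>(Basis :: 'a set). (\<integral>\<^sup>+t. ennreal (exp (- \<beta> * t\<^sup>2)) \<partial>lborel))"
    by (rule nn_integral_lborel_prod) auto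
  also have "\<dots> < \<infinity>"
    using fin by (simp add: power_less_top_ennreal)
  finally show ?thesis .
qed

lemma integrable_gaussian:
  "\<beta> > 0 \<Longrightarrow> integrable lborel (\<lambda>x :: 'a::euclidean_space. exp (- \<beta> * (norm x)\<^sup>2))"
  using nn_integral_gaussian_finite[of \<beta>, where 'a='a] by (simp add: integrable_iff_bounded)

lemma integral_gaussian_pos:
  assumes "\<beta> > 0"
  shows "(\<integral>x. exp (- \<beta> * (norm (x :: 'a::euclidean_space))\<^sup>2) \<partial>lborel) > 0"
proof (rule ccontr)
  let ?k = "\<lambda>x :: 'a. exp (- \<beta> * (norm x)\<^sup>2)"
  assume "\<not> ?thesis"
  then have "(\<integral>x. ?k x \<partial>lborel) = 0"
    by (intro antisym) (auto simp: not_less)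
  then have "AE x in lborel. ?k x = 0"
    using integral_nonneg_eq_0_iff_AE[OF integrable_gaussian[OF assms]] by (metis (mono_tags, lifting) AE_I2 exp_ge_zero)
  then show False
    by (simp add: eventually_False ae_filter_eq_bot_iff)
qed

text \<open>The radial mean value property for \<open>weyl_translate \<alpha> f z\<close> with a
  Gaussian weight, followed by the substitution \<open>w = z + u\<close>. The normalising constant
  is kept as a Gaussian integral.\<close>

lemma reproducing_formula:
  fixes f :: "complex ^ 'n \<Rightarrow> complex"
  assumes f: "entire f" and \<alpha>: "\<alpha> > 0" and bdd: "\<And>w. fock_modulus \<alpha> f w \<le> M"
  shows "has_bochner_integral lborel
    (\<lambda>w. exp (of_real \<alpha> * herm_inner z w - of_real (\<alpha> * (norm w)\<^sup>2)) * f w)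
    (f z * of_real (\<integral>u. exp (- \<alpha> * (norm (u :: complex ^ 'n))\<^sup>2) \<partial>lborel))"
proof -
  note [measurable] = entire_borel_measurable[OF f]
  let ?g = "weyl_translate \<alpha> f z"
  let ?k = "\<lambda>u :: complex ^ 'n. exp (- \<alpha> * (norm u)\<^sup>2)"
  let ?H = "\<lambda>w. exp (of_real \<alpha> * herm_inner z w - of_real (\<alpha> * (norm w)\<^sup>2)) * f w"
  note [measurable] = entire_borel_measurable[OF entire_weyl_translate[OF f]]
  have "continuous_on UNIV (herm_inner z)"
    unfolding herm_inner_def[abs_def] by (intro continuous_intros)
  then have [measurable]: "herm_inner z \<in> borel_measurable borel"
    by (rule borel_measurable_continuous_onI)
  \<comment> \<open>Expanding both inner products, \<open>\<langle>z, z + u\<rangle> - \<bar>z +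
    u\<bar>\<^sup>2 = - \<langle>u, z\<rangle> - \<bar>u\<bar>\<^sup>2\<close>.\<close>
  have H: "?g u * of_real (?k u) = ?H (z + u)" for u
  proof -
    have "of_real \<alpha> * herm_inner z (z + u) - of_real (\<alpha> * (norm (z + u))\<^sup>2)
        = - of_real \<alpha> * herm_inner u z + of_real (- \<alpha> * (norm u)\<^sup>2)"
      by (simp add: herm_inner_self[symmetric] herm_inner_add_left herm_inner_add_right algebra_simps
          del: of_real_power)
    then show ?thesis
      by (simp only: weyl_translate_def exp_add exp_of_real mult_ac)
  qed
  have "integrable lborel (\<lambda>u. M * exp (\<alpha> * (norm z)\<^sup>2 / 2) * exp (- (\<alpha> / 2) * (norm (u :: complex ^ 'n))\<^sup>2))"
    using \<alpha> by (intro integrable_mult_right integrable_gaussian) simp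
  then have int: "integrable lborel (\<lambda>u. ?g u * of_real (?k u))"
  proof (rule Bochner_Integration.integrable_bound)
    have "norm (?g u * of_real (?k u)) \<le> norm (M * exp (\<alpha> * (norm z)\<^sup>2 / 2) * exp (- (\<alpha> / 2) * (norm u)\<^sup>2))" for u
    proof -
      have "M \<ge> 0" using bdd[of 0] fock_modulus_nonneg[of \<alpha> f 0] by linarith
      have "norm (?g u * of_real (?k u)) = fock_modulus \<alpha> f (z + u) * exp (\<alpha> * (norm z)\<^sup>2 / 2) *
          (exp (\<alpha> * (norm u)\<^sup>2 / 2) * exp (- \<alpha> * (norm u)\<^sup>2))"
        by (simp add: norm_mult norm_weyl_translate)
      \<comment> \<open>The translate grows at most like
        \<open>exp (\<alpha> * (norm u)\<^sup>2 / 2)\<close>, so half of the Gaussian decay survives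
        and dominates the integrand.\<close>
      also have "exp (\<alpha> * (norm u)\<^sup>2 / 2) * exp (- \<alpha> * (norm u)\<^sup>2) = exp (- (\<alpha> / 2) * (norm u)\<^sup>2)"
        by (simp add: exp_add[symmetric])
      also have "fock_modulus \<alpha> f (z + u) * exp (\<alpha> * (norm z)\<^sup>2 / 2) * exp (- (\<alpha> / 2) * (norm u)\<^sup>2)
          \<le> M * exp (\<alpha> * (norm z)\<^sup>2 / 2) * exp (- (\<alpha> / 2) * (norm u)\<^sup>2)"
        using bdd by (intro mult_right_mono) auto
      finally show ?thesis using \<open>M \<ge> 0\<close> by simp
    qed
    then show "AE u in lborel. norm (?g u * of_real (?k u))
        \<le> norm (M * exp (\<alpha> * (norm z)\<^sup>2 / 2) * exp (- (\<alpha> / 2) * (norm u)\<^sup>2))" by simp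
  qed simp
  have "(\<integral>u. ?g u * of_real (?k u) \<partial>lborel) = ?g 0 * of_real (\<integral>u. ?k u \<partial>lborel)"
    by (rule entire_radial_mean_value[OF entire_weyl_translate[OF f] _ _ int])
      (auto simp: norm_vector_scalar_mult)
  with int have "has_bochner_integral lborel (\<lambda>u. ?H (z + u)) (f z * of_real (\<integral>u. ?k u \<partial>lborel))"
    unfolding H by (simp add: has_bochner_integral_iff)
  then have "has_bochner_integral (distr lborel borel ((+) z)) ?H (f z * of_real (\<integral>u. ?k u \<partial>lborel))"
    by (simp add: has_bochner_integral_iff integrable_distr_eq integral_distr)
  then show ?thesis by (simp add: lborel_distr_plus)
qed

text \<open>Tonelli: the centres \<open>z\<close> whose ball contains \<open>u\<close> form the ball
  of the same radius around \<open>u\<close>. Joint measurability holds because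
  \<open>dist z u < R\<close> defines an open subset of the product.\<close>

lemma nn_integral_over_balls:
  fixes F :: "'a::euclidean_space \<Rightarrow> ennreal"
  assumes [measurable]: "F \<in> borel_measurable borel"
  shows "(\<lambda>z. \<integral>\<^sup>+u. F u * indicator (ball z R) u \<partial>lborel) \<in> borel_measurable borel" (is ?m)
    and "(\<integral>\<^sup>+z. (\<integral>\<^sup>+u. F u * indicator (ball z R) u \<partial>lborel) \<partial>lborel)
      = emeasure lborel (ball (0 :: 'a) R) * (\<integral>\<^sup>+u. F u \<partial>lborel)" (is ?e)
proof -
  have ind: "indicator (ball z R) u = indicator {x. dist (fst x) (snd x) < R} (z, u)" for z u :: 'a
    by (simp add: indicator_def)
  have [measurable]: "{x :: 'a \<times> 'a. dist (fst x) (snd x) < R} \<in> sets (borel \<Otimes>\<^sub>M borel)"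
    unfolding borel_prod by (intro borel_open open_Collect_less continuous_intros)
  have [measurable]: "(\<lambda>(z, u). F u * indicator (ball z R) u) \<in> borel_measurable (lborel \<Otimes>\<^sub>M lborel)"
    unfolding ind by simp
  show ?m
    using lborel.borel_measurable_nn_integral[of "\<lambda>z u. F u * indicator (ball z R) u" lborel] by simp
  have "(\<integral>\<^sup>+z. (\<integral>\<^sup>+u. F u * indicator (ball z R) u \<partial>lborel) \<partial>lborel)
      = (\<integral>\<^sup>+u. (\<integral>\<^sup>+z. F u * indicator (ball z R) u \<partial>lborel) \<partial>lborel)"
    by (rule lborel_pair.Fubini'[symmetric]) simp
  also have "\<dots> = (\<integral>\<^sup>+u. emeasure lborel (ball (0 :: 'a) R) * F u \<partial>lborel)"
  proof (rule nn_integral_cong)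
    fix u :: 'a
    have "(\<integral>\<^sup>+z. indicator (ball z R) u \<partial>lborel) = (\<integral>\<^sup>+z. indicator (ball 0 R) (u - z) \<partial>(lborel :: 'a measure))"
      by (intro nn_integral_cong) (auto simp: dist_norm norm_minus_commute split: split_indicator)
    also have "\<dots> = emeasure lborel (ball (0 :: 'a) R)"
      by (subst nn_integral_lborel_reflect[OF borel_measurable_indicator]) auto
    finally have *: "(\<integral>\<^sup>+z. indicator (ball z R) u \<partial>lborel) = emeasure lborel (ball (0 :: 'a) R)" .
    have "(\<lambda>z. indicator (ball z R) u :: ennreal) = indicator (ball u R)"
      by (auto simp: fun_eq_iff dist_commute split: split_indicator)
    then have "(\<lambda>z. indicator (ball z R) u :: ennreal) \<in> borel_measurable lborel"
      by (metis borel_measurable_indicator sets_lborel borel_open open_ball)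
    then show "(\<integral>\<^sup>+z. F u * indicator (ball z R) u \<partial>lborel) = emeasure lborel (ball (0 :: 'a) R) * F u"
      by (simp add: nn_integral_cmult * mult.commute)
  qed
  also have "\<dots> = emeasure lborel (ball (0 :: 'a) R) * (\<integral>\<^sup>+u. F u \<partial>lborel)"
    by (rule nn_integral_cmult) simp
  finally show ?e .
qed

section \<open>Representing functions of the Fock space\<close>

lemma norm_fock_weighted:
  "norm (f z * complex_of_real (exp (- \<alpha> * (norm z)\<^sup>2 / 2))) = fock_modulus \<alpha> f z"
  by (simp add: norm_mult fock_modulus_def)

lemma fock_space_finite_iff:
  assumes "entire f" and "q > 0"
  shows "f \<in> fock_space \<alpha> (ennreal q) \<longleftrightarrow> (\<integral>\<^sup>+z. ennreal (fock_modulus \<alpha> f z powr q) \<partial>lborel) < \<infinity>"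
proof -
  note [measurable] = entire_borel_measurable[OF assms(1)] borel_measurable_fock_modulus[OF assms(1)]
  show ?thesis
    unfolding fock_space_def Lp_space_def mem_Collect_eq norm_fock_weighted
    using assms by (simp add: integrable_iff_bounded)
qed

lemma fock_space_infinity_iff:
  assumes "entire f"
  shows "f \<in> fock_space \<alpha> \<infinity> \<longleftrightarrow> (\<exists>M. AE z in lborel. fock_modulus \<alpha> f z \<le> M)"
proof -
  note [measurable] = entire_borel_measurable[OF assms(1)] borel_measurable_fock_modulus[OF assms(1)]
  have "f \<in> fock_space \<alpha> \<infinity> \<longleftrightarrow> esssup lborel (\<lambda>z. ereal (fock_modulus \<alpha> f z)) < \<infinity>"
    unfolding fock_space_def Lp_space_def mem_Collect_eq norm_fock_weighted
    using assms by simp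
  also have "\<dots> \<longleftrightarrow> (\<exists>M. AE z in lborel. fock_modulus \<alpha> f z \<le> M)"
  proof
    assume *: "esssup lborel (\<lambda>z. ereal (fock_modulus \<alpha> f z)) < \<infinity>"
    \<comment> \<open>Only a real upper bound is extracted, so the value -\<infinity> is covered as
      well.\<close>
    then obtain M where M: "esssup lborel (\<lambda>z. ereal (fock_modulus \<alpha> f z)) \<le> ereal M"
      by (cases "esssup lborel (\<lambda>z. ereal (fock_modulus \<alpha> f z))") auto
    have "AE z in lborel. ereal (fock_modulus \<alpha> f z) \<le> esssup lborel (\<lambda>z. ereal (fock_modulus \<alpha> f z))"
      by (rule esssup_AE)
    then have "AE z in lborel. fock_modulus \<alpha> f z \<le> M"
      by eventually_elim (use M order_trans in force)
    then show "\<exists>M. AE z in lborel. fock_modulus \<alpha> f z \<le> M" ..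
  next
    assume "\<exists>M. AE z in lborel. fock_modulus \<alpha> f z \<le> M"
    then obtain M where "AE z in lborel. fock_modulus \<alpha> f z \<le> M" ..
    then have "esssup lborel (\<lambda>z. ereal (fock_modulus \<alpha> f z)) \<le> ereal M"
      by (intro esssup_I) auto
    then show "esssup lborel (\<lambda>z. ereal (fock_modulus \<alpha> f z)) < \<infinity>" by auto
  qed
  finally show ?thesis .
qed

lemma ennreal_positive_cases:
  assumes "(0::ennreal) < p"
  obtains "p = \<infinity>" | q where "q > 0" "p = ennreal q"
  using assms by (cases p) auto

text \<open>The local integral in the mean bound is at most the global one when \<open>p\<close> is
  finite. For \<open>p = \<infinity>\<close> the mean bound with exponent 1 turns an almost
  everywhere bound into an everywhere bound. The result makes the reproducing formula available for
  every \<open>p\<close>.\<close>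

lemma fock_space_bounded:
  fixes f :: "complex ^ 'n \<Rightarrow> complex"
  assumes f: "entire f" and \<alpha>: "\<alpha> > 0" and p: "0 < p" and mem: "f \<in> fock_space \<alpha> p"
  obtains M where "\<And>z. fock_modulus \<alpha> f z \<le> M"
  using p
proof (cases rule: ennreal_positive_cases)
  case 1
  obtain K where K: "AE z in lborel. fock_modulus \<alpha> f z \<le> K"
    using mem 1 fock_space_infinity_iff[OF f] by blast
  obtain C where C: "C \<ge> 0" "\<And>z. ennreal (fock_modulus \<alpha> f z powr 1)
      \<le> ennreal C * (\<integral>\<^sup>+u. ennreal (fock_modulus \<alpha> f u powr 1) * indicator (ball z 1) u \<partial>lborel)"
    using fock_modulus_powr_le[OF f \<alpha>, of 1] by (metis zero_less_one)
  have "fock_modulus \<alpha> f z \<le> C * (max K 0 * measure lborel (ball (0 :: complex ^ 'n) 1))" for z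
  proof -
    have "ennreal (fock_modulus \<alpha> f z)
        \<le> ennreal C * (\<integral>\<^sup>+u. ennreal (fock_modulus \<alpha> f u) * indicator (ball z 1) u \<partial>lborel)"
      using C(2)[of z] by simp
    also have "(\<integral>\<^sup>+u. ennreal (fock_modulus \<alpha> f u) * indicator (ball z 1) u \<partial>lborel)
        \<le> (\<integral>\<^sup>+u. ennreal (max K 0) * indicator (ball z 1) u \<partial>lborel)"
      using K by (intro nn_integral_mono_AE, eventually_elim)
        (auto split: split_indicator intro!: ennreal_leI)
    also have "\<dots> = ennreal (max K 0) * emeasure lborel (ball z 1)"
      by (rule nn_integral_cmult_indicator) simp
    also have "\<dots> = ennreal (max K 0 * measure lborel (ball (0 :: complex ^ 'n) 1))"
      using content_ball_conv_unit_ball[of 1 z] emeasure_lborel_ball_finite[of z 1]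
      by (simp add: emeasure_eq_ennreal_measure ennreal_mult)
    finally have "ennreal (fock_modulus \<alpha> f z)
        \<le> ennreal (C * (max K 0 * measure lborel (ball (0 :: complex ^ 'n) 1)))"
      using C(1) by (simp add: ennreal_mult mult_left_mono)
    then show ?thesis
      using C(1) by (subst (asm) ennreal_le_iff) auto
  qed
  then show ?thesis by (rule that)
next
  case (2 q)
  let ?J = "\<integral>\<^sup>+u. ennreal (fock_modulus \<alpha> f u powr q) \<partial>lborel"
  have fin: "?J < \<infinity>" using mem 2 fock_space_finite_iff[OF f] by blast
  obtain C where C: "C \<ge> 0" "\<And>z. ennreal (fock_modulus \<alpha> f z powr q)
      \<le> ennreal C * (\<integral>\<^sup>+u. ennreal (fock_modulus \<alpha> f u powr q) * indicator (ball z 1) u \<partial>lborel)"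
    using fock_modulus_powr_le[OF f \<alpha>, of q] 2 by metis
  obtain J where J: "?J = ennreal J" "J \<ge> 0" using fin by (cases ?J) auto
  have "fock_modulus \<alpha> f z \<le> (C * J) powr (1 / q)" for z
  proof -
    have "ennreal (fock_modulus \<alpha> f z powr q)
      \<le> ennreal C * (\<integral>\<^sup>+u. ennreal (fock_modulus \<alpha> f u powr q) * indicator (ball z 1) u \<partial>lborel)"
      by (rule C)
    also have "\<dots> \<le> ennreal C * ?J"
      by (intro mult_left_mono nn_integral_mono) (auto split: split_indicator)
    also have "\<dots> = ennreal (C * J)" using C J by (simp add: ennreal_mult)
    finally have "fock_modulus \<alpha> f z powr q \<le> C * J"
      using C J by (subst (asm) ennreal_le_iff) auto
    then have "(fock_modulus \<alpha> f z powr q) powr (1 / q) \<le> (C * J) powr (1 / q)"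
      using 2 by (intro powr_mono2) auto
    then show ?thesis using 2 by (simp add: powr_powr)
  qed
  then show ?thesis by (rule that)
qed

text \<open>Unit balls around points of \<open>ball z r\<close> lie in
  \<open>ball z (r + 1)\<close>, so a single integral depending only on \<open>z\<close> controls
  all values on \<open>ball z r\<close>.\<close>

lemma fock_space_local_sup:
  fixes f :: "complex ^ 'n \<Rightarrow> complex"
  assumes f: "entire f" and \<alpha>: "\<alpha> > 0" and q: "0 < q"
  obtains C where "C \<ge> 0" "\<And>z w. w \<in> ball z r \<Longrightarrow> ennreal (fock_modulus \<alpha> f w powr q)
      \<le> ennreal C * (\<integral>\<^sup>+u. ennreal (fock_modulus \<alpha> f u powr q) * indicator (ball z (r + 1)) u \<partial>lborel)"
proof -
  obtain C where C: "C \<ge> 0" "\<And>z. ennreal (fock_modulus \<alpha> f z powr q)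
      \<le> ennreal C * (\<integral>\<^sup>+u. ennreal (fock_modulus \<alpha> f u powr q) * indicator (ball z 1) u \<partial>lborel)"
    using fock_modulus_powr_le[OF f \<alpha> q] by metis
  have "ennreal (fock_modulus \<alpha> f w powr q)
      \<le> ennreal C * (\<integral>\<^sup>+u. ennreal (fock_modulus \<alpha> f u powr q) * indicator (ball z (r + 1)) u \<partial>lborel)"
    if "w \<in> ball z r" for z w
  proof -
    have "ball w 1 \<subseteq> ball z (r + 1)"
    proof
      fix u assume "u \<in> ball w 1"
      then show "u \<in> ball z (r + 1)" using that dist_triangle[of z u w] by simp
    qed
    then have "(\<integral>\<^sup>+u. ennreal (fock_modulus \<alpha> f u powr q) * indicator (ball w 1) u \<partial>lborel)
      \<le> (\<integral>\<^sup>+u. ennreal (fock_modulus \<alpha> f u powr q) * indicator (ball z (r + 1)) u \<partial>lborel)"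
      by (intro nn_integral_mono) (auto split: split_indicator)
    then show ?thesis by (rule order_trans[OF C(2) mult_left_mono]) simp
  qed
  with C(1) show thesis by (rule that)
qed

lemma fock_space_imp_representation:
  fixes f :: "complex ^ 'n \<Rightarrow> complex"
  assumes \<alpha>: "\<alpha> > 0" and p: "0 < p" and r: "r > 0" and f: "entire f" and mem: "f \<in> fock_space \<alpha> p"
  shows "\<exists>\<nu> h. complex_borel_measure \<nu> h \<and> localized \<nu> r \<in> Lp_space lborel p \<and>
       (\<forall>z. has_complex_measure_integral \<nu> h
          (\<lambda>w. exp (complex_of_real \<alpha> * herm_inner z w
                     - complex_of_real (\<alpha> / 2 * (norm w)\<^sup>2)))
          (f z))"
proof -
  note [measurable] = entire_borel_measurable[OF f] borel_measurable_fock_modulus[OF f]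
  obtain M where M: "\<And>z. fock_modulus \<alpha> f z \<le> M"
    using fock_space_bounded[OF f \<alpha> p mem] by blast
  have M0: "M \<ge> 0" using M[of 0] fock_modulus_nonneg[of \<alpha> f 0] by linarith
  define c where "c = (\<integral>u. exp (- \<alpha> * (norm (u :: complex ^ 'n))\<^sup>2) \<partial>lborel)"
  have c: "c > 0" unfolding c_def by (rule integral_gaussian_pos[OF \<alpha>])
  \<comment> \<open>Division by \<open>c\<close> removes the constant from the reproducing
    formula.\<close>
  define \<nu> where "\<nu> = density lborel (\<lambda>w. ennreal (fock_modulus \<alpha> f w / c))"
  \<comment> \<open>The value 1 at zeros of \<open>f\<close> keeps \<open>norm (h w) = 1\<close>
    everywhere; the density of \<open>\<nu>\<close> vanishes at these points.\<close>
  define h where "h w = (if f w = 0 then 1 else sgn (f w))" for w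
  have [measurable]: "h \<in> borel_measurable borel"
    unfolding h_def[abs_def] by measurable
  define V where "V = measure lborel (ball (0 :: complex ^ 'n) r)"
  have V: "V \<ge> 0" by (simp add: V_def)
  have em_ball: "emeasure lborel (ball z r) = ennreal V" for z :: "complex ^ 'n"
    using r content_ball_conv_unit_ball[of r z] content_ball_conv_unit_ball[of r "0 :: complex ^ 'n"]
      emeasure_lborel_ball_finite[of z r]
    by (simp add: V_def emeasure_eq_ennreal_measure)
  have \<nu>_le: "emeasure \<nu> A \<le> ennreal (B / c) * emeasure lborel A"
    if [measurable]: "A \<in> sets borel" and B: "\<And>w. w \<in> A \<Longrightarrow> fock_modulus \<alpha> f w \<le> B" for A B
  proof -
    have "emeasure \<nu> A = (\<integral>\<^sup>+w. ennreal (fock_modulus \<alpha> f w / c) * indicator A w \<partial>lborel)"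
      unfolding \<nu>_def by (rule emeasure_density) auto
    also have "\<dots> \<le> (\<integral>\<^sup>+w. ennreal (B / c) * indicator A w \<partial>lborel)"
      using B c by (intro nn_integral_mono) (auto split: split_indicator intro!: ennreal_leI divide_right_mono)
    also have "\<dots> = ennreal (B / c) * emeasure lborel A"
      by (rule nn_integral_cmult_indicator) simp
    finally show ?thesis .
  qed
  have "complex_borel_measure \<nu> h"
    unfolding complex_borel_measure_def
  proof (intro conjI allI impI)
    show "norm (h w) = 1" for w by (simp add: h_def norm_sgn)
    fix K :: "(complex ^ 'n) set" assume K: "compact K"
    then have "K \<in> sets borel" by (intro borel_closed compact_imp_closed)
    then have "emeasure \<nu> K \<le> ennreal (M / c) * emeasure lborel K"
      using M by (rule \<nu>_le)
    also have "\<dots> < \<infinity>"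
      using emeasure_bounded_finite[OF compact_imp_bounded[OF K]]
      by (simp add: ennreal_mult_less_top)
    finally show "emeasure \<nu> K < \<infinity>" .
  qed (simp_all add: \<nu>_def)
  moreover have "has_complex_measure_integral \<nu> h
          (\<lambda>w. exp (complex_of_real \<alpha> * herm_inner z w - complex_of_real (\<alpha> / 2 * (norm w)\<^sup>2))) (f z)" for z
  proof -
    have "continuous_on UNIV (herm_inner z)"
      unfolding herm_inner_def[abs_def] by (intro continuous_intros)
    then have [measurable]: "herm_inner z \<in> borel_measurable borel"
      by (rule borel_measurable_continuous_onI)
    \<comment> \<open>The Gaussian \<open>exp (- \<alpha> * (norm w)\<^sup>2)\<close> of the
      reproducing formula is split evenly: one half belongs to the density and the other to the
      kernel, while \<open>h\<close> restores the phase of \<open>f w\<close>.\<close>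
    have eq: "(fock_modulus \<alpha> f w / c) *\<^sub>R
        (exp (complex_of_real \<alpha> * herm_inner z w - complex_of_real (\<alpha> / 2 * (norm w)\<^sup>2)) * h w)
        = exp (of_real \<alpha> * herm_inner z w - of_real (\<alpha> * (norm w)\<^sup>2)) * f w * of_real (1 / c)" for w
    proof -
      have "of_real (norm (f w)) * h w = f w"
        by (simp add: h_def sgn_div_norm scaleR_conv_of_real)
      moreover have "exp (of_real \<alpha> * herm_inner z w - of_real (\<alpha> * (norm w)\<^sup>2))
          = exp (complex_of_real \<alpha> * herm_inner z w - complex_of_real (\<alpha> / 2 * (norm w)\<^sup>2))
            * complex_of_real (exp (- \<alpha> * (norm w)\<^sup>2 / 2))"
      proof -
        have "\<alpha> * (norm w)\<^sup>2 = \<alpha> / 2 * (norm w)\<^sup>2 - (- \<alpha> * (norm w)\<^sup>2 / 2)" by simp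
        then have "of_real \<alpha> * herm_inner z w - complex_of_real (\<alpha> * (norm w)\<^sup>2)
          = (of_real \<alpha> * herm_inner z w - of_real (\<alpha> / 2 * (norm w)\<^sup>2)) + of_real (- \<alpha> * (norm w)\<^sup>2 / 2)"
          by (simp only: of_real_diff diff_diff_eq2 add_diff_eq diff_add_eq)
        then show ?thesis by (simp only: exp_add exp_of_real)
      qed
      ultimately show ?thesis
        using c by (simp add: fock_modulus_def scaleR_conv_of_real field_simps del: of_real_exp)
    qed
    have "has_bochner_integral lborel (\<lambda>w. (fock_modulus \<alpha> f w / c) *\<^sub>R
        (exp (complex_of_real \<alpha> * herm_inner z w - complex_of_real (\<alpha> / 2 * (norm w)\<^sup>2)) * h w))
        (f z * of_real c * of_real (1 / c))"
      unfolding eq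
      by (intro has_bochner_integral_mult_left reproducing_formula[OF f \<alpha> M, folded c_def])
    then have "has_bochner_integral \<nu>
        (\<lambda>w. exp (complex_of_real \<alpha> * herm_inner z w - complex_of_real (\<alpha> / 2 * (norm w)\<^sup>2)) * h w)
        (f z * of_real c * of_real (1 / c))"
      unfolding \<nu>_def using c by (intro has_bochner_integral_density) auto
    then show ?thesis
      unfolding has_complex_measure_integral_def using c by simp
  qed
  moreover have "localized \<nu> r \<in> Lp_space lborel p"
  proof -
    have \<nu>_ball: "emeasure \<nu> (ball z r)
        = (\<integral>\<^sup>+w. ennreal (fock_modulus \<alpha> f w / c) * indicator (ball z r) w \<partial>lborel)" for z
      unfolding \<nu>_def by (rule emeasure_density) auto
    \<comment> \<open>Measurability in the centre follows from writing the localized measure as an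
      integral over a moving ball.\<close>
    have "localized \<nu> r = (\<lambda>z. enn2real (\<integral>\<^sup>+w. ennreal (fock_modulus \<alpha> f w / c) * indicator (ball z r) w \<partial>lborel))"
      by (simp add: localized_def[abs_def] measure_def \<nu>_ball)
    also have "\<dots> \<in> borel_measurable lborel"
      using nn_integral_over_balls(1)[of "\<lambda>w. ennreal (fock_modulus \<alpha> f w / c)" r] by simp
    finally have meas [measurable]: "localized \<nu> r \<in> borel_measurable lborel" .
    have loc_le: "localized \<nu> r z \<le> B / c * V"
      if "\<And>w. w \<in> ball z r \<Longrightarrow> fock_modulus \<alpha> f w \<le> B" for z B
    proof -
      have B: "B \<ge> 0" using r by (intro order_trans[OF fock_modulus_nonneg that[of z]]) simp
      have "emeasure \<nu> (ball z r) \<le> ennreal (B / c) * emeasure lborel (ball z r)"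
        by (rule \<nu>_le[OF _ that]) auto
      then have "emeasure \<nu> (ball z r) \<le> ennreal (B / c * V)"
        using B c V by (simp only: em_ball ennreal_mult divide_nonneg_pos)
      then show ?thesis
        unfolding localized_def measure_def using B c V by (intro enn2real_leI) auto
    qed
    have loc_nn: "localized \<nu> r z \<ge> 0" for z by (simp add: localized_def)
    from p show ?thesis
    proof (cases rule: ennreal_positive_cases)
      case 1
      have "esssup lborel (\<lambda>z. ereal (norm (localized \<nu> r z))) \<le> ereal (M / c * V)"
        using loc_le[OF M] loc_nn by (intro esssup_I) auto
      then show ?thesis using 1 meas by (auto simp: Lp_space_def)
    next
      case (2 q)
      have fin: "(\<integral>\<^sup>+u. ennreal (fock_modulus \<alpha> f u powr q) \<partial>lborel) < \<infinity>"
        using mem 2 fock_space_finite_iff[OF f] by blast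
      obtain C where C: "C \<ge> 0" "\<And>z w. w \<in> ball z r \<Longrightarrow> ennreal (fock_modulus \<alpha> f w powr q)
        \<le> ennreal C * (\<integral>\<^sup>+u. ennreal (fock_modulus \<alpha> f u powr q) * indicator (ball z (r + 1)) u \<partial>lborel)"
        using fock_space_local_sup[OF f \<alpha> 2(1), where r=r] by metis
      have pt: "ennreal (norm (localized \<nu> r z) powr q) \<le> ennreal (C * (V / c) powr q) *
         (\<integral>\<^sup>+u. ennreal (fock_modulus \<alpha> f u powr q) * indicator (ball z (r + 1)) u \<partial>lborel)"
        (is "_ \<le> _ * ?J") for z
      proof -
        have "?J \<le> (\<integral>\<^sup>+u. ennreal (fock_modulus \<alpha> f u powr q) \<partial>lborel)"
          by (intro nn_integral_mono) (auto split: split_indicator)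
        then obtain J where J: "?J = ennreal J" "J \<ge> 0" using fin by (cases ?J) auto
        \<comment> \<open>The bound is uniform in \<open>w\<close>. Taking the power
          \<open>q\<close> after the integration over \<open>ball z r\<close> restores the first
          power of \<open>J\<close>, which can be integrated in \<open>z\<close> for every
          \<open>q > 0\<close>.\<close>
        have "fock_modulus \<alpha> f w \<le> (C * J) powr (1 / q)" if w: "w \<in> ball z r" for w
        proof -
          have "ennreal (fock_modulus \<alpha> f w powr q) \<le> ennreal (C * J)"
            using C(2)[OF w] C(1) J by (simp add: ennreal_mult)
          then have "fock_modulus \<alpha> f w powr q \<le> C * J"
            using C J by (subst (asm) ennreal_le_iff) auto
          then have "(fock_modulus \<alpha> f w powr q) powr (1 / q) \<le> (C * J) powr (1 / q)"
            using 2 by (intro powr_mono2) auto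
          then show ?thesis using 2 by (simp add: powr_powr)
        qed
        then have "localized \<nu> r z \<le> (C * J) powr (1 / q) / c * V" by (rule loc_le)
        then have "localized \<nu> r z powr q \<le> ((C * J) powr (1 / q) * (V / c)) powr q"
          using loc_nn 2 by (intro powr_mono2) auto
        also have "\<dots> = C * J * (V / c) powr q"
          using 2 C J by (simp only: powr_mult powr_powr) simp
        finally have "ennreal (norm (localized \<nu> r z) powr q) \<le> ennreal (C * (V / c) powr q * J)"
          using loc_nn by (intro ennreal_leI) (simp add: mult_ac)
        then show ?thesis using C J by (simp add: ennreal_mult)
      qed
      have [measurable]: "(\<lambda>z. \<integral>\<^sup>+u. ennreal (fock_modulus \<alpha> f u powr q) * indicator (ball z (r + 1)) u \<partial>lborel)
          \<in> borel_measurable borel"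
        by (rule nn_integral_over_balls(1)) simp
      have "(\<integral>\<^sup>+z. ennreal (norm (localized \<nu> r z) powr q) \<partial>lborel) \<le> (\<integral>\<^sup>+z. ennreal (C * (V / c) powr q) *
         (\<integral>\<^sup>+u. ennreal (fock_modulus \<alpha> f u powr q) * indicator (ball z (r + 1)) u \<partial>lborel) \<partial>lborel)"
        by (intro nn_integral_mono pt)
      also have "\<dots> = ennreal (C * (V / c) powr q) * (emeasure lborel (ball (0 :: complex ^ 'n) (r + 1))
          * (\<integral>\<^sup>+u. ennreal (fock_modulus \<alpha> f u powr q) \<partial>lborel))"
        by (subst nn_integral_cmult) (simp_all add: nn_integral_over_balls(2))
      also have "\<dots> < \<infinity>"
        using fin emeasure_lborel_ball_finite[of "0 :: complex ^ 'n" "r + 1"]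
        by (simp add: ennreal_mult_less_top)
      finally have "integrable lborel (\<lambda>z. norm (localized \<nu> r z) powr q)"
        unfolding integrable_iff_bounded by simp
      then show ?thesis using 2 meas by (simp add: Lp_space_def)
    qed
  qed
  ultimately show ?thesis by blast
qed

section \<open>Gaussian averages of measures\<close>

text \<open>Finitely many balls of radius 1/2 cover the unit ball. After scaling,
  \<open>card B\<close> translates of the ball of radius \<open>2 ^ m\<close> cover the one of
  radius \<open>2 ^ Suc m\<close>, so each doubling multiplies the number of centres by at most
  \<open>card B\<close>.\<close>

lemma dyadic_ball_cover:
  assumes "r > 0"
  obtains A :: "nat \<Rightarrow> 'a::euclidean_space set" and N0 N :: nat
  where "\<And>m. finite (A m)" "\<And>m. card (A m) \<le> N0 * N ^ m"
    "\<And>m. cball 0 (2 ^ m) \<subseteq> (\<Union>a\<in>A m. ball a r)"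
proof -
  have cover: "\<exists>k. finite k \<and> cball (0 :: 'a) 1 \<subseteq> (\<Union>x\<in>k. ball x e)" if "e > 0" for e
    using compact_cball[of "0 :: 'a" 1] that unfolding compact_eq_totally_bounded by blast
  obtain A0 where A0: "finite A0" "cball (0 :: 'a) 1 \<subseteq> (\<Union>x\<in>A0. ball x r)"
    using cover[OF assms] by blast
  obtain B where B: "finite B" "cball (0 :: 'a) 1 \<subseteq> (\<Union>x\<in>B. ball x (1/2))"
    using cover[of "1/2"] by auto
  define A where "A = rec_nat A0 (\<lambda>m S. (\<lambda>(b, a). 2 ^ Suc m *\<^sub>R b + a) ` (B \<times> S))"
  have A_0: "A 0 = A0" and A_Suc: "A (Suc m) = (\<lambda>(b, a). 2 ^ Suc m *\<^sub>R b + a) ` (B \<times> A m)" for m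
    by (simp_all add: A_def)
  have fin: "finite (A m)" for m
    by (induction m) (simp_all add: A_0 A_Suc A0 B del: power_Suc)
  moreover have "card (A m) \<le> card A0 * card B ^ m" for m
  proof (induction m)
    case (Suc m)
    have "card (A (Suc m)) \<le> card B * card (A m)"
      unfolding A_Suc card_cartesian_product[symmetric]
      by (rule card_image_le) (simp add: B fin)
    also have "\<dots> \<le> card B * (card A0 * card B ^ m)" by (rule mult_left_mono[OF Suc]) simp
    finally show ?case by (simp add: mult_ac)
  qed (simp add: A_0)
  moreover have "cball 0 (2 ^ m) \<subseteq> (\<Union>a\<in>A m. ball a r)" for m
  proof (induction m)
    case (Suc m)
    show ?case
    proof
      fix u :: 'a assume u: "u \<in> cball 0 (2 ^ Suc m)"
      define c :: real where "c = 2 ^ Suc m"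
      have c: "c > 0" by (simp add: c_def)
      have "(1 / c) *\<^sub>R u \<in> cball 0 1" using u c by (simp add: c_def)
      then have "(1 / c) *\<^sub>R u \<in> (\<Union>x\<in>B. ball x (1/2))" using B(2) by blast
      then obtain b where b: "b \<in> B" "norm (b - (1 / c) *\<^sub>R u) < 1 / 2"
        unfolding UN_iff mem_ball dist_norm by blast
      have "u - c *\<^sub>R b = - c *\<^sub>R (b - (1 / c) *\<^sub>R u)"
        using c by (simp add: algebra_simps)
      then have "norm (u - c *\<^sub>R b) = c * norm (b - (1 / c) *\<^sub>R u)"
        using c by (simp only: norm_scaleR)
      also have "\<dots> \<le> c * (1 / 2)" using b c by (intro mult_left_mono) auto
      finally have "u - c *\<^sub>R b \<in> cball 0 (2 ^ m)" by (simp add: c_def)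
      then obtain a where a: "a \<in> A m" "u - c *\<^sub>R b \<in> ball a r" using Suc by blast
      have "c *\<^sub>R b + a \<in> A (Suc m)" using a b by (force simp: A_Suc c_def)
      moreover have "u \<in> ball (c *\<^sub>R b + a) r" using a(2) by (simp add: dist_norm algebra_simps)
      ultimately show "u \<in> (\<Union>a\<in>A (Suc m). ball a r)" by blast
    qed
  qed (simp add: A_0 A0)
  ultimately show thesis by (rule that)
qed

lemma summable_power_times_exp_power:
  fixes \<beta> L :: real
  assumes "\<beta> > 0" "L > 1"
  shows "summable (\<lambda>m. L ^ m * exp (- \<beta> * 4 ^ m))"
proof (rule summable_comparison_test_bigo)
  show "summable (\<lambda>m. norm ((1/2) ^ m :: real))" by (simp add: summable_geometric)
  show "(\<lambda>m. L ^ m * exp (- \<beta> * 4 ^ m)) \<in> O(\<lambda>m. (1/2) ^ m)"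
    using assms by real_asymp
qed

text \<open>Points are sorted into dyadic shells; \<open>e m\<close> dominates the Gaussian on the
  shell of outer radius \<open>2 ^ m\<close> and decays so fast that every positive power of it
  outweighs the geometric growth of \<open>card (A m)\<close>.\<close>

lemma gaussian_ball_cover:
  assumes \<alpha>: "\<alpha> > 0" and r: "r > 0"
  obtains A :: "nat \<Rightarrow> 'a::euclidean_space set" and e :: "nat \<Rightarrow> real"
  where "\<And>m. finite (A m)" "\<And>m. e m > 0"
    "\<And>s. s > 0 \<Longrightarrow> summable (\<lambda>m. real (card (A m)) * e m powr s)"
    "\<And>x. \<exists>m. \<exists>a\<in>A m. x \<in> ball a r \<and> exp (- \<alpha> / 2 * (norm x)\<^sup>2) \<le> e m"
proof -
  obtain A :: "nat \<Rightarrow> 'a set" and N0 N :: nat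
    where A: "\<And>m. finite (A m)" "\<And>m. card (A m) \<le> N0 * N ^ m"
      "\<And>m. cball 0 (2 ^ m) \<subseteq> (\<Union>a\<in>A m. ball a r)"
    using dyadic_ball_cover[OF r] by blast
  \<comment> \<open>On a shell with \<open>m > 0\<close> one has
    \<open>(norm x)\<^sup>2 > 4 ^ m / 4\<close>, which accounts for the 8. Subtracting 1 gives
    \<open>e 0 = 1\<close>, as needed on the unit ball, where there is no lower bound for the
    norm.\<close>
  define e where "e m = exp (- (\<alpha> / 8) * (4 ^ m - 1))" for m :: nat
  have "summable (\<lambda>m. real (card (A m)) * e m powr s)" if s: "s > 0" for s
  proof -
    \<comment> \<open>Adding 2 ensures \<open>L > 1\<close> even when \<open>N\<close> is 0.\<close>
    define L where "L = real N + 2"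
    have "summable (\<lambda>m. real N0 * exp (\<alpha> / 8 * s) * (L ^ m * exp (- (\<alpha> / 8 * s) * 4 ^ m)))"
      using \<alpha> s by (intro summable_mult summable_power_times_exp_power) (auto simp: L_def)
    then show ?thesis
    proof (rule summable_comparison_test')
      fix m :: nat
      have "real (card (A m)) \<le> real (N0 * N ^ m)" using A(2)[of m] by (rule of_nat_mono)
      also have "\<dots> \<le> real N0 * L ^ m" by (simp add: L_def mult_left_mono power_mono)
      finally have "real (card (A m)) * e m powr s \<le> real N0 * L ^ m * e m powr s"
        by (rule mult_right_mono) simp
      moreover have "e m powr s = exp (\<alpha> / 8 * s) * exp (- (\<alpha> / 8 * s) * 4 ^ m)"
        by (simp add: e_def exp_powr_real exp_add[symmetric] algebra_simps)
      ultimately have "real (card (A m)) * e m powr s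
          \<le> real N0 * L ^ m * (exp (\<alpha> / 8 * s) * exp (- (\<alpha> / 8 * s) * 4 ^ m))"
        by metis
      then show "norm (real (card (A m)) * e m powr s)
          \<le> real N0 * exp (\<alpha> / 8 * s) * (L ^ m * exp (- (\<alpha> / 8 * s) * 4 ^ m))"
        by (simp add: mult_ac)
    qed
  qed
  moreover have "\<exists>m. \<exists>a\<in>A m. x \<in> ball a r \<and> exp (- \<alpha> / 2 * (norm x)\<^sup>2) \<le> e m" for x
  proof -
    \<comment> \<open>Minimality of \<open>m\<close> supplies the lower bound
      \<open>2 ^ (m - 1) < norm x\<close> when \<open>m > 0\<close>.\<close>
    define m where "m = (LEAST m. norm x \<le> 2 ^ m)"
    have "\<exists>m. norm x \<le> 2 ^ m"
      using real_arch_pow[of 2 "norm x"] by (auto intro: less_imp_le)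
    then have m: "norm x \<le> 2 ^ m" unfolding m_def by (rule LeastI_ex)
    then obtain a where a: "a \<in> A m" "x \<in> ball a r" using A(3)[of m] by force
    have "exp (- \<alpha> / 2 * (norm x)\<^sup>2) \<le> e m"
    proof (cases m)
      case 0
      then show ?thesis using \<alpha> by (simp add: e_def)
    next
      case (Suc k)
      then have "2 ^ k < norm x"
        using not_less_Least[of k "\<lambda>m. norm x \<le> 2 ^ m"] by (simp add: m_def not_le)
      then have "(2 ^ k)\<^sup>2 \<le> (norm x)\<^sup>2" by (intro power_mono) auto
      then have "(4 ^ m - 1) / 4 \<le> (norm x)\<^sup>2"
        by (simp add: Suc power_mult[symmetric] mult.commute[of k] power_mult)
      then have "\<alpha> / 2 * ((4 ^ m - 1) / 4) \<le> \<alpha> / 2 * (norm x)\<^sup>2"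
        using \<alpha> by (intro mult_left_mono) auto
      then show ?thesis by (simp add: e_def)
    qed
    with a show ?thesis by blast
  qed
  ultimately show thesis using A(1) by (intro that[of A e]) (auto simp: e_def)
qed

lemma suminf_sum_mult_ennreal:
  fixes A :: "nat \<Rightarrow> 'a set"
  assumes "\<And>m. 0 \<le> c m" "summable (\<lambda>m. real (card (A m)) * c m)"
  shows "(\<Sum>m. \<Sum>a\<in>A m. ennreal (c m) * t) = ennreal (\<Sum>m. real (card (A m)) * c m) * t"
proof -
  have "(\<Sum>a\<in>A m. ennreal (c m) * t) = ennreal (real (card (A m)) * c m) * t" for m
    using assms(1) by (simp add: ennreal_mult ennreal_of_nat_eq_real_of_nat mult.assoc)
  then show ?thesis
    using assms by (simp add: suminf_ennreal2)
qed

text \<open>At each point one term of the double sum already dominates the Gaussian. The cover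
  around the origin is moved to \<open>z\<close>, so the centres are \<open>a + z\<close> with
  \<open>a\<close> independent of \<open>z\<close>.\<close>

lemma nn_integral_gaussian_le:
  fixes \<nu> :: "'a::euclidean_space measure"
  assumes sets: "sets \<nu> = sets borel" and fin: "\<And>m. finite (A m)" and e: "\<And>m. e m > 0"
    and cover: "\<And>x. \<exists>m. \<exists>a\<in>A m. x \<in> ball a r \<and> exp (- \<alpha> / 2 * (norm x)\<^sup>2) \<le> e m"
  shows "(\<integral>\<^sup>+w. ennreal (exp (- \<alpha> / 2 * (norm (w - z))\<^sup>2)) \<partial>\<nu>)
    \<le> (\<Sum>m. \<Sum>a\<in>A m. ennreal (e m) * emeasure \<nu> (ball (a + z) r))"
proof -
  have ball: "ball x r \<in> sets \<nu>" for x :: 'a by (simp add: sets)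
  have [measurable]: "(\<lambda>w. ennreal (e m) * indicator (ball x r) w) \<in> borel_measurable \<nu>" for m x
    by (intro borel_measurable_times_ennreal borel_measurable_const borel_measurable_indicator ball)
  have "(\<integral>\<^sup>+w. ennreal (exp (- \<alpha> / 2 * (norm (w - z))\<^sup>2)) \<partial>\<nu>)
      \<le> (\<integral>\<^sup>+w. (\<Sum>m. \<Sum>a\<in>A m. ennreal (e m) * indicator (ball (a + z) r) w) \<partial>\<nu>)"
  proof (rule nn_integral_mono)
    fix w
    obtain m a where ma: "a \<in> A m" "w - z \<in> ball a r" "exp (- \<alpha> / 2 * (norm (w - z))\<^sup>2) \<le> e m"
      using cover[of "w - z"] by blast
    let ?t = "\<lambda>m. \<Sum>a\<in>A m. ennreal (e m) * indicator (ball (a + z) r) w"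
    have "w \<in> ball (a + z) r" using ma(2) by (simp add: dist_norm algebra_simps)
    then have "ennreal (exp (- \<alpha> / 2 * (norm (w - z))\<^sup>2)) \<le> ennreal (e m) * indicator (ball (a + z) r) w"
      using ma(3) by (simp add: ennreal_leI)
    also have "\<dots> \<le> ?t m"
      by (rule member_le_sum[OF ma(1)]) (simp_all add: fin)
    also have "\<dots> \<le> (\<Sum>m. ?t m)"
      using sum_le_suminf[of ?t "{m}"] by simp
    finally show "ennreal (exp (- \<alpha> / 2 * (norm (w - z))\<^sup>2)) \<le> (\<Sum>m. ?t m)" .
  qed
  also have "\<dots> = (\<Sum>m. \<Sum>a\<in>A m. ennreal (e m) * emeasure \<nu> (ball (a + z) r))"
    using ball by (simp add: nn_integral_suminf nn_integral_sum nn_integral_cmult_indicator)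
  finally show ?thesis .
qed

text \<open>Completing the square in the real part of the exponent.\<close>

lemma norm_fock_kernel:
  "norm (exp (complex_of_real \<alpha> * herm_inner z w - complex_of_real (\<alpha> / 2 * (norm w)\<^sup>2)))
    * exp (- \<alpha> * (norm z)\<^sup>2 / 2) = exp (- \<alpha> / 2 * (norm (w - z))\<^sup>2)"
proof -
  have "(norm (w - z))\<^sup>2 = (norm w)\<^sup>2 + (norm z)\<^sup>2 - 2 * Re (herm_inner z w)"
    using norm_add_herm[of w "- z"] by (simp add: herm_inner_def sum_negf)
  then have "\<alpha> * (norm (w - z))\<^sup>2 = \<alpha> * ((norm w)\<^sup>2 + (norm z)\<^sup>2 - 2 * Re (herm_inner z w))"
    by (rule arg_cong)
  then have "- \<alpha> / 2 * (norm (w - z))\<^sup>2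
      = (\<alpha> * Re (herm_inner z w) - \<alpha> / 2 * (norm w)\<^sup>2) + (- \<alpha> * (norm z)\<^sup>2 / 2)"
    by (simp add: field_simps)
  then show ?thesis
    by (simp only: exp_add) simp
qed

text \<open>Every term satisfies \<open>e\<^sub>m\<^sup>1\<^sup>/\<^sup>2 \<phi>(a) \<le> T\<^sup>1\<^sup>/\<^sup>q\<close>, where \<open>T\<close> is the sum on the right; the other
  factor \<open>e\<^sub>m\<^sup>1\<^sup>/\<^sup>2\<close> is summable. Unlike Hoelder's inequality this works for all \<open>q > 0\<close>.\<close>

lemma suminf_powr_le:
  fixes \<phi> :: "'a \<Rightarrow> real" and A :: "nat \<Rightarrow> 'a set"
  assumes q: "q > 0" and fin: "\<And>m. finite (A m)" and e: "\<And>m. e m > 0"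
    and sm: "summable (\<lambda>m. real (card (A m)) * e m powr (1/2))" and \<phi>: "\<And>a. \<phi> a \<ge> 0"
    and x: "x \<ge> 0" "ennreal x \<le> (\<Sum>m. \<Sum>a\<in>A m. ennreal (e m) * ennreal (\<phi> a))"
  shows "ennreal (x powr q) \<le> ennreal ((1 + (\<Sum>m. real (card (A m)) * e m powr (1/2))) powr q)
     * (\<Sum>m. \<Sum>a\<in>A m. ennreal (e m powr (q / 2)) * ennreal (\<phi> a powr q))"
    (is "_ \<le> ennreal ((1 + ?C) powr q) * ?T")
proof (cases "?T = \<infinity>")
  case True
  have "?C \<ge> 0" using sm by (intro suminf_nonneg) auto
  \<comment> \<open>The summand 1 keeps the factor positive when \<open>?C = 0\<close>, so its
    product with \<infinity> is \<infinity>.\<close>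
  then have "(1 + ?C) powr q > 0" by simp
  then show ?thesis unfolding True by (simp add: ennreal_mult_top)
next
  case False
  then obtain t where t: "?T = ennreal t" "t \<ge> 0" by (cases ?T) auto
  have C: "?C \<ge> 0" using sm by (intro suminf_nonneg) auto
  let ?t = "\<lambda>m. \<Sum>a\<in>A m. ennreal (e m powr (q / 2)) * ennreal (\<phi> a powr q)"
  have term_le: "e m powr (1/2) * \<phi> a \<le> t powr (1 / q)" if a: "a \<in> A m" for m a
  proof -
    have "ennreal (e m powr (q / 2) * \<phi> a powr q) \<le> ?t m"
      unfolding ennreal_mult''[OF powr_ge_zero]
      by (rule member_le_sum[OF a, of "\<lambda>a. ennreal (e m powr (q / 2)) * ennreal (\<phi> a powr q)"]) (simp_all add: fin)
    also have "\<dots> \<le> (\<Sum>m. ?t m)"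
      using sum_le_suminf[of ?t "{m}"] by simp
    also have "\<dots> = ennreal t" by (rule t)
    finally have "e m powr (q / 2) * \<phi> a powr q \<le> t"
      using t by (subst (asm) ennreal_le_iff) auto
    then have "(e m powr (1/2) * \<phi> a) powr q \<le> t"
      by (simp add: powr_mult powr_powr)
    then have "((e m powr (1/2) * \<phi> a) powr q) powr (1 / q) \<le> t powr (1 / q)"
      using q by (intro powr_mono2) auto
    then show ?thesis using q \<phi> by (simp add: powr_powr)
  qed
  have "ennreal x \<le> (\<Sum>m. \<Sum>a\<in>A m. ennreal (e m) * ennreal (\<phi> a))" by (rule x)
  also have "\<dots> \<le> (\<Sum>m. \<Sum>a\<in>A m. ennreal (e m powr (1/2)) * ennreal (t powr (1 / q)))"
  proof (intro suminf_le sum_mono summableI)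
    fix m a assume a: "a \<in> A m"
    have "e m = e m powr (1/2) * e m powr (1/2)"
      using e[of m] by (simp flip: powr_add)
    then have "e m * \<phi> a = e m powr (1/2) * (e m powr (1/2) * \<phi> a)" by simp
    also have "\<dots> \<le> e m powr (1/2) * t powr (1 / q)"
      by (intro mult_left_mono term_le a) auto
    finally show "ennreal (e m) * ennreal (\<phi> a) \<le> ennreal (e m powr (1/2)) * ennreal (t powr (1 / q))"
      using e[of m] \<phi> by (simp add: ennreal_mult[symmetric] less_imp_le ennreal_leI)
  qed
  also have "\<dots> = ennreal ?C * ennreal (t powr (1 / q))"
    by (rule suminf_sum_mult_ennreal[OF _ sm]) simp
  also have "\<dots> = ennreal (?C * t powr (1 / q))" using C by (simp add: ennreal_mult)
  finally have "x \<le> ?C * t powr (1 / q)"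
    using C by (subst (asm) ennreal_le_iff) auto
  also have "\<dots> \<le> (1 + ?C) * t powr (1 / q)" by (simp add: algebra_simps)
  finally have "x powr q \<le> ((1 + ?C) * t powr (1 / q)) powr q"
    using x q by (intro powr_mono2) auto
  also have "\<dots> = (1 + ?C) powr q * t"
    using q t by (simp add: powr_mult powr_powr)
  finally have "ennreal (x powr q) \<le> ennreal ((1 + ?C) powr q * t)" by (rule ennreal_leI)
  then show ?thesis using t by (simp add: ennreal_mult)
qed

section \<open>From a representing measure to the Fock space\<close>

lemma AE_lborel_translate:
  fixes P :: "'a::euclidean_space \<Rightarrow> bool"
  assumes "AE z in lborel. P z" and [measurable]: "Measurable.pred borel P"
  shows "AE z in lborel. P (a + z)"
proof -
  have "AE z in distr lborel borel ((+) a). P z" unfolding lborel_distr_plus by (rule assms(1))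
  then show ?thesis by (subst (asm) AE_distr_iff) simp_all
qed

lemma representation_imp_fock_space:
  fixes f :: "complex ^ 'n \<Rightarrow> complex"
  assumes \<alpha>: "\<alpha> > 0" and p: "0 < p" and r: "r > 0" and f: "entire f"
    and \<nu>: "complex_borel_measure \<nu> h" and loc: "localized \<nu> r \<in> Lp_space lborel p"
    and rep: "\<And>z. has_complex_measure_integral \<nu> h
          (\<lambda>w. exp (complex_of_real \<alpha> * herm_inner z w - complex_of_real (\<alpha> / 2 * (norm w)\<^sup>2))) (f z)"
  shows "f \<in> fock_space \<alpha> p"
proof -
  note [measurable] = entire_borel_measurable[OF f] borel_measurable_fock_modulus[OF f]
  have sets: "sets \<nu> = sets borel" and compact: "\<And>K. compact K \<Longrightarrow> emeasure \<nu> K < \<infinity>"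
    and h: "\<And>w. norm (h w) = 1"
    using \<nu> by (auto simp: complex_borel_measure_def)
  note sets[measurable_cong]
  have meas [measurable]: "localized \<nu> r \<in> borel_measurable borel"
    using loc by (simp add: Lp_space_def)
  have loc_nn: "localized \<nu> r z \<ge> 0" for z by (simp add: localized_def)
  have em: "emeasure \<nu> (ball z r) = ennreal (localized \<nu> r z)" for z
  proof -
    have "emeasure \<nu> (ball z r) \<le> emeasure \<nu> (cball z r)"
      by (intro emeasure_mono ball_subset_cball) (simp add: sets)
    also have "\<dots> < \<infinity>" by (rule compact) simp
    finally show ?thesis by (simp add: localized_def emeasure_eq_ennreal_measure)
  qed
  obtain A :: "nat \<Rightarrow> (complex ^ 'n) set" and e
    where fin: "\<And>m. finite (A m)" and e: "\<And>m. e m > 0"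
      and sm: "\<And>s. s > 0 \<Longrightarrow> summable (\<lambda>m. real (card (A m)) * e m powr s)"
      and cover: "\<And>x. \<exists>m. \<exists>a\<in>A m. x \<in> ball a r \<and> exp (- \<alpha> / 2 * (norm x)\<^sup>2) \<le> e m"
    using gaussian_ball_cover[OF \<alpha> r] by blast
  \<comment> \<open>As \<open>h\<close> has modulus 1, the weighted kernel has modulus
    \<open>exp (- \<alpha> / 2 * (norm (w - z))\<^sup>2)\<close>, and the cover bounds its integral
    by weighted translates of the localized function.\<close>
  have le: "ennreal (fock_modulus \<alpha> f z) \<le> (\<Sum>m. \<Sum>a\<in>A m. ennreal (e m) * ennreal (localized \<nu> r (a + z)))" for z
  proof -
    let ?g = "\<lambda>w. exp (complex_of_real \<alpha> * herm_inner z w - complex_of_real (\<alpha> / 2 * (norm w)\<^sup>2))"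
    let ?c = "exp (- \<alpha> * (norm z)\<^sup>2 / 2)"
    have hb: "has_bochner_integral \<nu> (\<lambda>w. ?g w * h w) (f z)"
      using rep[of z] by (simp only: has_complex_measure_integral_def)
    have [measurable]: "(\<lambda>w. ?g w * h w) \<in> borel_measurable \<nu>"
      using hb by (rule borel_measurable_has_bochner_integral)
    have "ennreal (fock_modulus \<alpha> f z) = ennreal (norm (f z)) * ennreal ?c"
      by (simp add: fock_modulus_def ennreal_mult)
    also have "\<dots> \<le> (\<integral>\<^sup>+w. ennreal (norm (?g w * h w)) \<partial>\<nu>) * ennreal ?c"
      by (intro mult_right_mono has_bochner_integral_norm_bound[OF hb]) simp
    also have "\<dots> = (\<integral>\<^sup>+w. ennreal (norm (?g w * h w)) * ennreal ?c \<partial>\<nu>)"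
      by (rule nn_integral_multc[symmetric]) measurable
    also have "\<dots> = (\<integral>\<^sup>+w. ennreal (exp (- \<alpha> / 2 * (norm (w - z))\<^sup>2)) \<partial>\<nu>)"
    proof (rule nn_integral_cong)
      fix w
      have "norm (?g w * h w) * ?c = exp (- \<alpha> / 2 * (norm (w - z))\<^sup>2)"
        unfolding norm_mult h using norm_fock_kernel[of \<alpha> z w] by (simp only: mult_1_right)
      then show "ennreal (norm (?g w * h w)) * ennreal ?c = ennreal (exp (- \<alpha> / 2 * (norm (w - z))\<^sup>2))"
        by (metis ennreal_mult' norm_ge_zero)
    qed
    also have "\<dots> \<le> (\<Sum>m. \<Sum>a\<in>A m. ennreal (e m) * emeasure \<nu> (ball (a + z) r))"
      by (rule nn_integral_gaussian_le[OF sets fin e cover])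
    finally show ?thesis by (simp only: em)
  qed
  from p show ?thesis
  proof (cases rule: ennreal_positive_cases)
    case 1
    have "esssup lborel (\<lambda>z. ereal (norm (localized \<nu> r z))) < \<infinity>"
      using loc 1 by (simp add: Lp_space_def)
    then obtain K where K: "esssup lborel (\<lambda>z. ereal (norm (localized \<nu> r z))) \<le> ereal K"
      by (cases "esssup lborel (\<lambda>z. ereal (norm (localized \<nu> r z)))") auto
    have "AE z in lborel. ereal (norm (localized \<nu> r z)) \<le> esssup lborel (\<lambda>z. ereal (norm (localized \<nu> r z)))"
      by (rule esssup_AE)
    then have "AE z in lborel. localized \<nu> r z \<le> K"
      by eventually_elim (use K order_trans loc_nn in force)
    then have "AE z in lborel. localized \<nu> r (a + z) \<le> K" for a
      by (rule AE_lborel_translate) simp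
    \<comment> \<open>Only countably many translates occur, so the exceptional null sets can be
      united.\<close>
    then have "AE z in lborel. \<forall>m. \<forall>a\<in>A m. localized \<nu> r (a + z) \<le> K"
      using fin by (simp add: AE_all_countable AE_finite_all)
    then have "AE z in lborel. fock_modulus \<alpha> f z \<le> (\<Sum>m. real (card (A m)) * e m) * max K 0"
    proof eventually_elim
      case (elim z)
      have sm1: "summable (\<lambda>m. real (card (A m)) * e m)" using sm[of 1] e by (simp add: less_imp_le)
      have S: "(\<Sum>m. real (card (A m)) * e m) \<ge> 0"
        using e by (intro suminf_nonneg sm1) (simp add: less_imp_le)
      have "ennreal (fock_modulus \<alpha> f z) \<le> (\<Sum>m. \<Sum>a\<in>A m. ennreal (e m) * ennreal (localized \<nu> r (a + z)))"
        by (rule le)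
      also have "\<dots> \<le> (\<Sum>m. \<Sum>a\<in>A m. ennreal (e m) * ennreal (max K 0))"
        using elim by (intro suminf_le sum_mono summableI mult_left_mono ennreal_leI) (auto simp: le_max_iff_disj)
      also have "\<dots> = ennreal (\<Sum>m. real (card (A m)) * e m) * ennreal (max K 0)"
        using e by (intro suminf_sum_mult_ennreal sm1) (simp add: less_imp_le)
      also have "\<dots> = ennreal ((\<Sum>m. real (card (A m)) * e m) * max K 0)"
        using S by (simp add: ennreal_mult)
      finally show ?case using S by (subst (asm) ennreal_le_iff) auto
    qed
    then show ?thesis using 1 fock_space_infinity_iff[OF f] by blast
  next
    case (2 q)
    let ?C = "ennreal ((1 + (\<Sum>m. real (card (A m)) * e m powr (1/2))) powr q)"
    let ?I = "\<integral>\<^sup>+z. ennreal (localized \<nu> r z powr q) \<partial>lborel"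
    have I: "?I < \<infinity>"
      using loc 2 loc_nn by (simp add: Lp_space_def integrable_iff_bounded)
    have "(\<integral>\<^sup>+z. ennreal (fock_modulus \<alpha> f z powr q) \<partial>lborel)
      \<le> (\<integral>\<^sup>+z. ?C * (\<Sum>m. \<Sum>a\<in>A m. ennreal (e m powr (q / 2)) * ennreal (localized \<nu> r (a + z) powr q)) \<partial>lborel)"
      by (intro nn_integral_mono suminf_powr_le 2 fin e sm loc_nn le fock_modulus_nonneg) simp
    also have "\<dots> = ?C * (\<Sum>m. \<Sum>a\<in>A m. ennreal (e m powr (q / 2)) * (\<integral>\<^sup>+z. ennreal (localized \<nu> r (a + z) powr q) \<partial>lborel))"
      by (simp add: nn_integral_cmult nn_integral_suminf nn_integral_sum)
    \<comment> \<open>By translation invariance every integral equals \<open>?I\<close>; what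
      remains is the total weight with exponent \<open>q / 2\<close>, which is finite.\<close>
    also have "\<dots> = ?C * (\<Sum>m. \<Sum>a\<in>A m. ennreal (e m powr (q / 2)) * ?I)"
      by (subst nn_integral_lborel_translate[of "\<lambda>z. ennreal (localized \<nu> r z powr q)"]) simp_all
    also have "(\<Sum>m. \<Sum>a\<in>A m. ennreal (e m powr (q / 2)) * ?I)
        = ennreal (\<Sum>m. real (card (A m)) * e m powr (q / 2)) * ?I"
      using 2 by (intro suminf_sum_mult_ennreal sm) auto
    also have "?C * \<dots> < \<infinity>"
      using I by (simp add: ennreal_mult_less_top)
    finally show ?thesis using 2 fock_space_finite_iff[OF f] by blast
  qed
qed

theorem theorem10:
  fixes \<alpha> r :: real and p :: ennreal and f :: "complex ^ 'n \<Rightarrow> complex"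
  assumes "\<alpha> > 0" and "0 < p" and "r > 0" and "entire f"
  shows "f \<in> fock_space \<alpha> p \<longleftrightarrow>
    (\<exists>\<nu> h. complex_borel_measure \<nu> h \<and>
       localized \<nu> r \<in> Lp_space lborel p \<and>
       (\<forall>z. has_complex_measure_integral \<nu> h
          (\<lambda>w. exp (complex_of_real \<alpha> * herm_inner z w
                     - complex_of_real (\<alpha> / 2 * (norm w)\<^sup>2)))
          (f z)))"
  using representation_imp_fock_space[OF assms] fock_space_imp_representation[OF assms]
  by blast

end
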